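(* Let $H$ be an $n\times n$ Hermitian matrix. Then the following hold. (i) If $n\geq 5$, then $H$ is $3$-spectrally monomorphic if and only if $H$ is $\Gamma$-equivalent to $H_n(c)$ for some complex number $c$, or $H$ is $\Gamma$-equivalent to $iS$ for some $n\times n$ skew-symmetric matrix $S$ whose off-diagonal entries are all in $\{-1,1\}$ (here $i$ is the imaginary unit). (ii) If $n\geq 7$, then $H$ is $4$-spectrally monomorphic if and only if $H$ is $\Gamma$-equivalent to $H_n(c)$ for some complex number $c$.
   Context: For an $n\times n$ complex matrix $A$ and $\alpha\subseteq\{1,\ldots,n\}$, $A[\alpha]$ denotes the principal submatrix of $A$ with rows and columns indexed by $\alpha$. The matrix $A$ is $k$-spectrally monomorphic if all its $k\times k$ principal submatrices $A[\alpha]$, $|\alpha|=k$, have the same characteristic polynomial. Let $\Gamma$ be the subgroup of $GL_n(\mathbb{C})$ generated by the unitary diagonal matrices (diagonal matrices whose diagonal entries have modulus $1$) and the permutation matrices. Two $n\times n$ Hermitian matrices $H_1,H_2$ are $\Gamma$-equivalent if $H_2=a(SH_1S^{*})+bI$ for some real numbers $a\neq 0$ and $b$ and some $S\in\Gamma$. This is an equivalence relation. For a complex number $c$, $H_n(c)$ is the $n\times n$ Hermitian matrix with zero diagonal, all entries strictly above the diagonal equal to $c$, and all entries strictly below the diagonal equal to $\overline{c}$. *)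

theory Defs
  imports
    "Jordan_Normal_Form.Char_Poly"
    "Jordan_Normal_Form.DL_Submatrix"
    "Jordan_Normal_Form.Schur_Decomposition"
    "HOL-Algebra.Generated_Groups"
    "HOL-Combinatorics.Permutations"
begin

text \<open>Rows and columns are indexed by \<open>{..<n}\<close> instead of \<open>{1..n}\<close>.\<close>

definition hermitian_mat :: "nat \<Rightarrow> complex mat \<Rightarrow> bool" where
  "hermitian_mat n A \<longleftrightarrow> A \<in> carrier_mat n n \<and> mat_adjoint A = A"

definition spectrally_monomorphic :: "nat \<Rightarrow> nat \<Rightarrow> complex mat \<Rightarrow> bool" where
  "spectrally_monomorphic n k A \<longleftrightarrow> A \<in> carrier_mat n n \<and>
     (\<forall>\<alpha> \<beta>. \<alpha> \<subseteq> {..<n} \<longrightarrow> card \<alpha> = k \<longrightarrow> \<beta> \<subseteq> {..<n} \<longrightarrow> card \<beta> = k \<longrightarrow>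
        char_poly (submatrix A \<alpha> \<alpha>) = char_poly (submatrix A \<beta> \<beta>))"

definition unitary_diagonal_mats :: "nat \<Rightarrow> complex mat set" where
  "unitary_diagonal_mats n =
     {D \<in> carrier_mat n n. diagonal_mat D \<and> (\<forall>i<n. cmod (D $$ (i, i)) = 1)}"

definition permutation_mats :: "nat \<Rightarrow> complex mat set" where
  "permutation_mats n =
     {mat n n (\<lambda>(i, j). if i = p j then 1 else 0) | p. p permutes {..<n}}"

text \<open>The last argument of \<^const>\<open>ring_mat\<close> only fills the extension slot of the record.\<close>

definition GL :: "nat \<Rightarrow> complex mat monoid" where
  "GL n = units_of (ring_mat TYPE(complex) n ())"

definition Gamma_group :: "nat \<Rightarrow> complex mat set" where
  "Gamma_group n = generate (GL n) (unitary_diagonal_mats n \<union> permutation_mats n)"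

definition Gamma_equivalent :: "nat \<Rightarrow> complex mat \<Rightarrow> complex mat \<Rightarrow> bool" where
  "Gamma_equivalent n H1 H2 \<longleftrightarrow> hermitian_mat n H1 \<and> hermitian_mat n H2 \<and>
     (\<exists>a b :: real. \<exists>S \<in> Gamma_group n. a \<noteq> 0 \<and>
        H2 = complex_of_real a \<cdot>\<^sub>m (S * H1 * mat_adjoint S) + complex_of_real b \<cdot>\<^sub>m 1\<^sub>m n)"

definition H_mat :: "nat \<Rightarrow> complex \<Rightarrow> complex mat" where
  "H_mat n c = mat n n (\<lambda>(i, j). if i < j then c else if j < i then cnj c else 0)"

definition skew_symmetric_mat :: "nat \<Rightarrow> complex mat \<Rightarrow> bool" where
  "skew_symmetric_mat n S \<longleftrightarrow> S \<in> carrier_mat n n \<and> transpose_mat S = - S"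

text \<open>Sanity checks: the generators of \<open>Gamma_group n\<close> do lie in \<open>GL n\<close> (the definition of
  \<^const>\<open>generate\<close> does not require this), and \<open>mat_adjoint\<close> is the conjugate transpose.\<close>

lemma mat_adjoint_index:
  assumes "A \<in> carrier_mat n n" "i < n" "j < n"
  shows "mat_adjoint A $$ (i, j) = conjugate (A $$ (j, i))"
  using assms by (simp add: mat_adjoint_def mat_of_rows_def)

lemma unitary_diagonal_mats_subset_GL: "unitary_diagonal_mats n \<subseteq> carrier (GL n)"
proof
  fix D assume "D \<in> unitary_diagonal_mats n"
  then have D: "D \<in> carrier_mat n n" and diag: "\<And>i j. i < n \<Longrightarrow> j < n \<Longrightarrow> i \<noteq> j \<Longrightarrow> D $$ (i, j) = 0"
    and nz: "\<And>i. i < n \<Longrightarrow> D $$ (i, i) \<noteq> 0"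
    by (auto simp: unitary_diagonal_mats_def diagonal_mat_def)
  define E where "E = mat n n (\<lambda>(i, j). if i = j then inverse (D $$ (i, i)) else 0)"
  have E: "E \<in> carrier_mat n n" by (simp add: E_def)
  have "D * E = 1\<^sub>m n"
  proof (rule eq_matI)
    fix i j assume "i < dim_row (1\<^sub>m n :: complex mat)" "j < dim_col (1\<^sub>m n :: complex mat)"
    then have ij: "i < n" "j < n" by auto
    have "(D * E) $$ (i, j) = (\<Sum>k\<in>{0..<n}. D $$ (i, k) * E $$ (k, j))"
      using ij D E by (simp add: scalar_prod_def)
    also have "\<dots> = (\<Sum>k\<in>{0..<n}. if k = j then D $$ (i, j) * inverse (D $$ (j, j)) else 0)"
      using ij by (intro sum.cong) (auto simp: E_def)
    finally show "(D * E) $$ (i, j) = 1\<^sub>m n $$ (i, j)"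
      using ij diag nz by auto
  qed (use D E in auto)
  moreover from this have "E * D = 1\<^sub>m n"
    by (rule mat_mult_left_right_inverse[OF D E])
  ultimately show "D \<in> carrier (GL n)"
    using D E by (auto simp: GL_def units_of_def Units_def ring_mat_def)
qed

lemma permutation_mats_subset_GL: "permutation_mats n \<subseteq> carrier (GL n)"
proof
  fix P assume "P \<in> permutation_mats n"
  then obtain p where p: "p permutes {..<n}"
    and P_def: "P = mat n n (\<lambda>(i, j). if i = p j then 1 else 0)"
    by (auto simp: permutation_mats_def)
  have P: "P \<in> carrier_mat n n" by (simp add: P_def)
  have T: "transpose_mat P \<in> carrier_mat n n" using P by simp
  have "transpose_mat P * P = 1\<^sub>m n"
  proof (rule eq_matI)
    fix i j assume "i < dim_row (1\<^sub>m n :: complex mat)" "j < dim_col (1\<^sub>m n :: complex mat)"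
    then have ij: "i < n" "j < n" by auto
    have pj: "p j < n" using p ij by (metis lessThan_iff permutes_in_image)
    have "(transpose_mat P * P) $$ (i, j) = (\<Sum>k\<in>{0..<n}. P $$ (k, i) * P $$ (k, j))"
      using ij P by (simp add: scalar_prod_def)
    also have "\<dots> = (\<Sum>k\<in>{0..<n}. if k = p j then (if p i = p j then 1 else 0) else 0)"
      using ij by (intro sum.cong) (auto simp: P_def)
    also have "\<dots> = (if p i = p j then 1 else 0)" using pj by simp
    finally show "(transpose_mat P * P) $$ (i, j) = 1\<^sub>m n $$ (i, j)"
      using ij permutes_inj[OF p] by (auto dest: injD)
  qed (use P in auto)
  moreover from this have "P * transpose_mat P = 1\<^sub>m n"
    by (rule mat_mult_left_right_inverse[OF T P])
  ultimately show "P \<in> carrier (GL n)"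
    using P T by (auto simp: GL_def units_of_def Units_def ring_mat_def)
qed

end

theory Submission
  imports Defs
begin

text \<open>
  The group generated by the unitary diagonal and the permutation matrices consists of the matrices
  \<open>P D\<close>, so \<open>\<Gamma>\<close>-equivalence relabels the indices, multiplies the entry \<open>(i, j)\<close> by
  \<open>v i * cnj (v j)\<close>, and applies a real affine map to the spectrum. It therefore preserves
  \<open>k\<close>-monomorphy (\<open>Gamma_equivalent_spectrally_monomorphic\<close>). All principal submatrices of order
  \<open>k\<close> of \<open>H_mat n c\<close> are equal to \<open>H_mat k c\<close>; and if \<open>S\<close> is skew-symmetric with off-diagonal
  entries \<open>\<plusminus>1\<close>, then \<open>\<i> S\<close> has only principal \<open>3 \<times> 3\<close> submatrices with characteristic polynomial
  \<open>x^3 - 3 x\<close>, because the product of its entries along a triangle is imaginary. This settles one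
  direction.

  For the converse, the trace of a principal submatrix is a sum of vertex weights, the diagonal
  entries. Once the diagonal is constant and has been subtracted, the next two coefficients of
  the characteristic polynomial are, up to sign, the sums of an edge weight \<open>|h_ij|^2\<close> and of a
  triangle weight \<open>2 Re (h_ij h_jk h_ki)\<close> over the edges and triangles of the index set. A function on the
  \<open>m\<close>-subsets of an \<open>n\<close>-set whose sums over the \<open>k\<close>-subsets all agree is constant when
  \<open>m \<le> min k (n - k)\<close>. The cases needed here follow from one another by exchanging one vertex of the
  \<open>k\<close>-subset for another one, which turns a statement about \<open>m\<close>-subsets into one about
  \<open>(m - 1)\<close>-subsets. Hence the diagonal is constant, the off-diagonal entries have a common modulus
  \<open>r\<close>, and the triangle weights are constant (\<open>spectrally_monomorphic_3_weights\<close>,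
  \<open>spectrally_monomorphic_4_weights\<close>).

  If \<open>r = 0\<close>, then \<open>H\<close> is scalar. Otherwise scale to \<open>r = 1\<close> and normalize the phases such that the
  first row is constant \<open>\<omega>\<close>, the product along one fixed triangle through vertex \<open>0\<close>. Constancy of the
  triangle weights through \<open>0\<close> then forces every off-diagonal entry to be \<open>\<omega>\<close> or \<open>cnj \<omega>\<close>
  (\<open>switching_normalization\<close>). For \<open>\<omega>\<close> real these agree, and the matrix is \<open>H_mat n \<omega>\<close>. For \<open>\<omega>\<close> not
  real the matrix is the same as a tournament. If the tournament is acyclic,
  it is a linear order, and sorting the vertices along it gives \<open>H_mat n \<omega>\<close>. If it has
  a cyclic triangle, then \<open>Re (\<omega>^3) = Re \<omega>\<close>, hence \<open>\<omega> = \<plusminus>\<i>\<close> and the matrix is \<open>\<i> S\<close>. The last case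
  is excluded by \<open>4\<close>-monomorphy: the \<open>4 \<times> 4\<close> principal minor of \<open>\<i> S\<close> on \<open>0\<close> and a further triangle is the
  square of a Pfaffian, \<open>9\<close> if the triangle is cyclic and \<open>1\<close> if not, so one cyclic triangle would make all
  triangles avoiding \<open>0\<close> cyclic, which is impossible in a tournament on four vertices
  (\<open>acyclic_if_squares_const\<close>).
\<close>

section \<open>Unitary monomial matrices\<close>

definition monomial_mat :: "nat \<Rightarrow> (nat \<Rightarrow> nat) \<Rightarrow> (nat \<Rightarrow> complex) \<Rightarrow> complex mat" where
  "monomial_mat n p v = mat n n (\<lambda>(i, j). if i = p j then v j else 0)"

text \<open>The products of a permutation matrix with a unitary diagonal matrix; they are shown to
  form the group \<^const>\<open>Gamma_group\<close>.\<close>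

definition unitary_monomial_mats :: "nat \<Rightarrow> complex mat set" where
  "unitary_monomial_mats n =
     {monomial_mat n p v | p v. p permutes {..<n} \<and> (\<forall>i<n. cmod (v i) = 1)}"

lemma monomial_mat_carrier [simp]: "monomial_mat n p v \<in> carrier_mat n n"
  by (simp add: monomial_mat_def)

lemma mat_adjoint_carrier: "A \<in> carrier_mat n n \<Longrightarrow> mat_adjoint A \<in> carrier_mat n n"
  by (auto simp: mat_adjoint_def)

lemma permutes_less: "p permutes {..<n} \<Longrightarrow> i < n \<Longrightarrow> p i < (n::nat)"
  by (metis lessThan_iff permutes_in_image)

lemma permutes_eq_iff: "p permutes A \<Longrightarrow> p i = p j \<longleftrightarrow> i = j"
  by (metis permutes_inj inj_eq)

lemma unit_mult_cnj: "cmod z = 1 \<Longrightarrow> z * cnj z = 1" "cmod z = 1 \<Longrightarrow> cnj z * z = 1"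
  using complex_norm_square[of z] by (simp_all add: mult.commute)

lemma monomial_mat_mult_index:
  assumes p: "p permutes {..<n}" and A: "A \<in> carrier_mat n n" and ij: "i < n" "j < n"
  shows "(monomial_mat n p v * A) $$ (p i, j) = v i * A $$ (i, j)"
proof -
  have pi: "p i < n" using permutes_less[OF p] ij by blast
  have "(monomial_mat n p v * A) $$ (p i, j) = (\<Sum>k\<in>{0..<n}. (if p i = p k then v k else 0) * A $$ (k, j))"
    using pi ij A by (simp add: monomial_mat_def scalar_prod_def)
  also have "\<dots> = (\<Sum>k\<in>{0..<n}. if k = i then v i * A $$ (i, j) else 0)"
    by (intro sum.cong) (auto simp: permutes_eq_iff[OF p])
  finally show ?thesis using ij by simp
qed

lemma adjoint_monomial_mat_index:
  "i < n \<Longrightarrow> j < n \<Longrightarrow>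
    mat_adjoint (monomial_mat n p v) $$ (i, j) = (if j = p i then cnj (v i) else 0)"
  by (subst mat_adjoint_index[OF monomial_mat_carrier]) (auto simp: monomial_mat_def)

lemma mult_adjoint_monomial_mat_index:
  assumes p: "p permutes {..<n}" and A: "A \<in> carrier_mat n n" and ij: "i < n" "j < n"
  shows "(A * mat_adjoint (monomial_mat n p v)) $$ (i, p j) = A $$ (i, j) * cnj (v j)"
proof -
  have pj: "p j < n" using permutes_less[OF p] ij by blast
  have adj: "mat_adjoint (monomial_mat n p v) \<in> carrier_mat n n"
    by (rule mat_adjoint_carrier[OF monomial_mat_carrier])
  have "(A * mat_adjoint (monomial_mat n p v)) $$ (i, p j)
      = (\<Sum>k\<in>{0..<n}. A $$ (i, k) * mat_adjoint (monomial_mat n p v) $$ (k, p j))"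
    using pj ij A adj by (simp add: scalar_prod_def)
  also have "\<dots> = (\<Sum>k\<in>{0..<n}. if k = j then A $$ (i, j) * cnj (v j) else 0)"
    using pj by (intro sum.cong)
      (auto simp: adjoint_monomial_mat_index permutes_eq_iff[OF p])
  finally show ?thesis using ij by simp
qed

lemma monomial_conjugation_index:
  assumes p: "p permutes {..<n}" and A: "A \<in> carrier_mat n n" and ij: "i < n" "j < n"
  shows "(monomial_mat n p v * A * mat_adjoint (monomial_mat n p v)) $$ (p i, p j)
       = v i * A $$ (i, j) * cnj (v j)"
  using mult_adjoint_monomial_mat_index[OF p mult_carrier_mat[OF monomial_mat_carrier A] permutes_less[OF p ij(1)] ij(2)]
    monomial_mat_mult_index[OF p A ij] by simp

lemma eq_mat_permuted:
  assumes p: "p permutes {..<n}" and A: "A \<in> carrier_mat n n" and B: "B \<in> carrier_mat n n"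
    and eq: "\<And>i j. i < n \<Longrightarrow> j < n \<Longrightarrow> A $$ (p i, p j) = B $$ (p i, p j)"
  shows "A = B"
proof (rule eq_matI)
  fix i j assume "i < dim_row B" "j < dim_col B"
  then have ij: "i < n" "j < n" using B by auto
  then have "i \<in> p ` {..<n}" "j \<in> p ` {..<n}" by (simp_all add: permutes_image[OF p])
  then show "A $$ (i, j) = B $$ (i, j)" using eq by auto
qed (use A B in auto)

lemma mat_adjoint_monomial_mat:
  assumes p: "p permutes {..<n}"
  shows "mat_adjoint (monomial_mat n p v) = monomial_mat n (Hilbert_Choice.inv p) (\<lambda>j. cnj (v (Hilbert_Choice.inv p j)))"
proof (rule eq_matI)
  fix i j assume "i < dim_row (monomial_mat n (Hilbert_Choice.inv p) (\<lambda>j. cnj (v (Hilbert_Choice.inv p j))))"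
    "j < dim_col (monomial_mat n (Hilbert_Choice.inv p) (\<lambda>j. cnj (v (Hilbert_Choice.inv p j))))"
  then have ij: "i < n" "j < n" by (auto simp: monomial_mat_def)
  have "j = p i \<longleftrightarrow> i = Hilbert_Choice.inv p j" using permutes_inv_eq[OF p] by metis
  then show "mat_adjoint (monomial_mat n p v) $$ (i, j)
      = monomial_mat n (Hilbert_Choice.inv p) (\<lambda>j. cnj (v (Hilbert_Choice.inv p j))) $$ (i, j)"
    unfolding adjoint_monomial_mat_index[OF ij] by (simp add: monomial_mat_def ij)
qed (use mat_adjoint_carrier[OF monomial_mat_carrier[of n p v]] in \<open>auto simp: monomial_mat_def\<close>)

lemma monomial_mat_mult:
  assumes p: "p permutes {..<n}" and q: "q permutes {..<n}"
  shows "monomial_mat n p v * monomial_mat n q w = monomial_mat n (p \<circ> q) (\<lambda>j. v (q j) * w j)"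
proof (rule eq_matI)
  fix i j assume "i < dim_row (monomial_mat n (p \<circ> q) (\<lambda>j. v (q j) * w j))"
    "j < dim_col (monomial_mat n (p \<circ> q) (\<lambda>j. v (q j) * w j))"
  then have ij: "i < n" "j < n" by (auto simp: monomial_mat_def)
  have "p (Hilbert_Choice.inv p i) = i" using permutes_inverses[OF p] by simp
  moreover have i': "Hilbert_Choice.inv p i < n" using ij permutes_less[OF permutes_inv[OF p]] by blast
  ultimately have "(monomial_mat n p v * monomial_mat n q w) $$ (i, j)
      = v (Hilbert_Choice.inv p i) * monomial_mat n q w $$ (Hilbert_Choice.inv p i, j)"
    using monomial_mat_mult_index[OF p monomial_mat_carrier[of n q w] i' ij(2), where v = v] by simp
  also have "\<dots> = monomial_mat n (p \<circ> q) (\<lambda>j. v (q j) * w j) $$ (i, j)"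
    using ij i' permutes_inv_eq[OF p, of i "q j"] by (auto simp: monomial_mat_def)
  finally show "(monomial_mat n p v * monomial_mat n q w) $$ (i, j) = \<dots>" .
qed (simp_all add: monomial_mat_def)

lemma monomial_mat_id: "monomial_mat n id (\<lambda>_. 1) = 1\<^sub>m n"
  by (rule eq_matI) (auto simp: monomial_mat_def)

lemma monomial_mat_cong:
  "(\<And>i. i < n \<Longrightarrow> v i = w i) \<Longrightarrow> monomial_mat n p v = monomial_mat n p w"
  by (auto simp: monomial_mat_def intro!: cong_mat)

lemma unitary_monomial_mult_adjoint:
  assumes p: "p permutes {..<n}" and v: "\<And>i. i < n \<Longrightarrow> cmod (v i) = 1"
  shows "monomial_mat n p v * mat_adjoint (monomial_mat n p v) = 1\<^sub>m n"
    "mat_adjoint (monomial_mat n p v) * monomial_mat n p v = 1\<^sub>m n"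
proof -
  have "monomial_mat n p v * mat_adjoint (monomial_mat n p v) =
      monomial_mat n id (\<lambda>j. v (Hilbert_Choice.inv p j) * cnj (v (Hilbert_Choice.inv p j)))"
    by (simp add: mat_adjoint_monomial_mat[OF p] monomial_mat_mult[OF p permutes_inv[OF p]]
        permutes_inv_o[OF p])
  also have "\<dots> = monomial_mat n id (\<lambda>_. 1)"
    by (rule monomial_mat_cong) (simp add: unit_mult_cnj v permutes_less[OF permutes_inv[OF p]])
  finally show *: "monomial_mat n p v * mat_adjoint (monomial_mat n p v) = 1\<^sub>m n"
    by (simp add: monomial_mat_id)
  then show "mat_adjoint (monomial_mat n p v) * monomial_mat n p v = 1\<^sub>m n"
    by (rule mat_mult_left_right_inverse[OF monomial_mat_carrier mat_adjoint_carrier[OF monomial_mat_carrier]])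
qed

lemma unitary_diagonal_mats_monomial:
  "unitary_diagonal_mats n = {monomial_mat n id v | v. \<forall>i<n. cmod (v i) = 1}"
proof (intro equalityI subsetI)
  fix D assume "D \<in> unitary_diagonal_mats n"
  then have D: "D \<in> carrier_mat n n" "diagonal_mat D" "\<forall>i<n. cmod (D $$ (i, i)) = 1"
    by (auto simp: unitary_diagonal_mats_def)
  then have "D = monomial_mat n id (\<lambda>i. D $$ (i, i))"
    by (intro eq_matI) (auto simp: monomial_mat_def diagonal_mat_def)
  then show "D \<in> {monomial_mat n id v | v. \<forall>i<n. cmod (v i) = 1}" using D by blast
next
  fix D assume "D \<in> {monomial_mat n id v | v. \<forall>i<n. cmod (v i) = 1}"
  then show "D \<in> unitary_diagonal_mats n"
    by (auto simp: unitary_diagonal_mats_def monomial_mat_def diagonal_mat_def)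
qed

lemma permutation_mats_monomial:
  "permutation_mats n = {monomial_mat n p (\<lambda>_. 1) | p. p permutes {..<n}}"
  by (simp add: permutation_mats_def monomial_mat_def)

lemma generators_subset_unitary_monomial:
  "unitary_diagonal_mats n \<union> permutation_mats n \<subseteq> unitary_monomial_mats n"
proof
  fix S assume "S \<in> unitary_diagonal_mats n \<union> permutation_mats n"
  then consider v where "S = monomial_mat n id v" "\<forall>i<n. cmod (v i) = 1"
    | p where "S = monomial_mat n p (\<lambda>_. 1)" "p permutes {..<n}"
    unfolding unitary_diagonal_mats_monomial permutation_mats_monomial by blast
  then show "S \<in> unitary_monomial_mats n"
  proof cases
    case 1
    then show ?thesis unfolding unitary_monomial_mats_def using permutes_id by blast
  next
    case 2
    moreover have "\<forall>i<n. cmod ((\<lambda>_. 1) i) = 1" by simp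
    ultimately show ?thesis unfolding unitary_monomial_mats_def by blast
  qed
qed

text \<open>Closure of the monomial matrices under the inverses that \<^const>\<open>generate\<close> adds: \<^const>\<open>GL\<close> is the
  group of units of the matrix ring, where the two-sided inverse found above is the inverse.\<close>

lemma inv_GL_unitary_monomial:
  assumes p: "p permutes {..<n}" and v: "\<And>i. i < n \<Longrightarrow> cmod (v i) = 1"
  shows "inv\<^bsub>GL n\<^esub> (monomial_mat n p v) = mat_adjoint (monomial_mat n p v)"
proof -
  interpret semiring "ring_mat TYPE(complex) n ()" by (rule semiring_mat)
  let ?S = "monomial_mat n p v"
  have adj: "mat_adjoint ?S \<in> carrier_mat n n" by (simp add: mat_adjoint_carrier)
  have inv: "?S * mat_adjoint ?S = 1\<^sub>m n" "mat_adjoint ?S * ?S = 1\<^sub>m n"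
    using unitary_monomial_mult_adjoint[OF p, of v] v by auto
  have U: "?S \<in> Units (ring_mat TYPE(complex) n ())"
    unfolding Units_def ring_mat_simps using inv adj by auto
  have "mat_adjoint ?S = inv\<^bsub>ring_mat TYPE(complex) n ()\<^esub> ?S"
    by (rule inv_unique') (use inv adj in \<open>auto simp: ring_mat_simps\<close>)
  then show ?thesis using units_of_inv[OF U] by (simp add: GL_def)
qed

text \<open>Monomial matrices contain the generators and are closed under products and adjoints, and
  each of them factors as a permutation matrix times a diagonal matrix.\<close>

lemma Gamma_group_eq_unitary_monomial: "Gamma_group n = unitary_monomial_mats n"
proof (intro equalityI subsetI)
  fix S assume "S \<in> Gamma_group n"
  then show "S \<in> unitary_monomial_mats n" unfolding Gamma_group_def
  proof (induction rule: generate.induct)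
    case one
    have "\<one>\<^bsub>GL n\<^esub> = monomial_mat n id (\<lambda>_. 1)"
      by (simp add: GL_def units_of_def ring_mat_simps monomial_mat_id)
    moreover have "\<forall>i<n. cmod ((\<lambda>_. 1) i) = 1" by simp
    ultimately show ?case unfolding unitary_monomial_mats_def using permutes_id by blast
  next
    case (incl h)
    then show ?case using generators_subset_unitary_monomial by blast
  next
    case (inv h)
    then obtain p v where pv: "h = monomial_mat n p v" "p permutes {..<n}" "\<forall>i<n. cmod (v i) = 1"
      using generators_subset_unitary_monomial unfolding unitary_monomial_mats_def by blast
    have "inv\<^bsub>GL n\<^esub> h = monomial_mat n (Hilbert_Choice.inv p) (\<lambda>j. cnj (v (Hilbert_Choice.inv p j)))"
      using pv by (simp add: inv_GL_unitary_monomial mat_adjoint_monomial_mat)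
    moreover have "\<forall>i<n. cmod (cnj (v (Hilbert_Choice.inv p i))) = 1"
      using pv permutes_less[OF permutes_inv[OF pv(2)]] by simp
    ultimately show ?case
      unfolding unitary_monomial_mats_def using permutes_inv[OF pv(2)] by blast
  next
    case (eng h1 h2)
    then obtain p v q w where
      pv: "h1 = monomial_mat n p v" "p permutes {..<n}" "\<forall>i<n. cmod (v i) = 1" and
      qw: "h2 = monomial_mat n q w" "q permutes {..<n}" "\<forall>i<n. cmod (w i) = 1"
      unfolding unitary_monomial_mats_def by blast
    have "h1 \<otimes>\<^bsub>GL n\<^esub> h2 = monomial_mat n (p \<circ> q) (\<lambda>j. v (q j) * w j)"
      using pv qw by (simp add: GL_def units_of_def ring_mat_simps monomial_mat_mult)
    moreover have "\<forall>i<n. cmod (v (q i) * w i) = 1"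
      using pv qw permutes_less[OF qw(2)] by (simp add: norm_mult)
    ultimately show ?case
      unfolding unitary_monomial_mats_def using permutes_compose[OF qw(2) pv(2)] by blast
  qed
next
  fix S assume "S \<in> unitary_monomial_mats n"
  then obtain p v where pv: "S = monomial_mat n p v" "p permutes {..<n}" "\<forall>i<n. cmod (v i) = 1"
    unfolding unitary_monomial_mats_def by blast
  have "monomial_mat n p (\<lambda>_. 1) \<otimes>\<^bsub>GL n\<^esub> monomial_mat n id v = S"
    using pv by (simp add: GL_def units_of_def ring_mat_simps monomial_mat_mult permutes_id)
  moreover have "monomial_mat n p (\<lambda>_. 1) \<in> Gamma_group n" "monomial_mat n id v \<in> Gamma_group n"
    unfolding Gamma_group_def unitary_diagonal_mats_monomial permutation_mats_monomial
    by (rule generate.incl; use pv in blast)+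
  ultimately show "S \<in> Gamma_group n"
    unfolding Gamma_group_def by (metis generate.eng)
qed

text \<open>The form in which \<open>\<Gamma>\<close>-equivalence is used everywhere below: no matrix products remain.\<close>

lemma Gamma_equivalent_iff_entries:
  "Gamma_equivalent n A B \<longleftrightarrow> hermitian_mat n A \<and> hermitian_mat n B \<and>
     (\<exists>(a::real) (b::real) p v. a \<noteq> 0 \<and> p permutes {..<n} \<and> (\<forall>i<n. cmod (v i) = 1) \<and>
        (\<forall>i<n. \<forall>j<n. B $$ (p i, p j) =
           complex_of_real a * (v i * A $$ (i, j) * cnj (v j)) + (if i = j then complex_of_real b else 0)))"
proof -
  have entries: "B = complex_of_real a \<cdot>\<^sub>m (monomial_mat n p v * A * mat_adjoint (monomial_mat n p v))
        + complex_of_real b \<cdot>\<^sub>m 1\<^sub>m n \<longleftrightarrow>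
      (\<forall>i<n. \<forall>j<n. B $$ (p i, p j) =
        complex_of_real a * (v i * A $$ (i, j) * cnj (v j)) + (if i = j then complex_of_real b else 0))"
    if A: "A \<in> carrier_mat n n" and B: "B \<in> carrier_mat n n" and p: "p permutes {..<n}"
    for a b :: real and p v
  proof -
    let ?S = "monomial_mat n p v"
    let ?C = "complex_of_real a \<cdot>\<^sub>m (?S * A * mat_adjoint ?S) + complex_of_real b \<cdot>\<^sub>m 1\<^sub>m n"
    have adj: "mat_adjoint ?S \<in> carrier_mat n n" by (simp add: mat_adjoint_carrier)
    have SAS: "?S * A * mat_adjoint ?S \<in> carrier_mat n n"
      by (rule mult_carrier_mat[OF mult_carrier_mat[OF monomial_mat_carrier A] adj])
    have C: "?C \<in> carrier_mat n n" using SAS by simp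
    have "?C $$ (p i, p j) =
        complex_of_real a * (v i * A $$ (i, j) * cnj (v j)) + (if i = j then complex_of_real b else 0)"
      if "i < n" "j < n" for i j
      using that SAS monomial_conjugation_index[OF p A that, of v] permutes_less[OF p]
      by (simp add: permutes_eq_iff[OF p] del: index_mult_mat)
    then show ?thesis using eq_mat_permuted[OF p B C] by auto
  qed
  have same: "(\<exists>S\<in>unitary_monomial_mats n. a \<noteq> 0 \<and>
          B = complex_of_real a \<cdot>\<^sub>m (S * A * mat_adjoint S) + complex_of_real b \<cdot>\<^sub>m 1\<^sub>m n) \<longleftrightarrow>
      (\<exists>p v. a \<noteq> 0 \<and> p permutes {..<n} \<and> (\<forall>i<n. cmod (v i) = 1) \<and>
        (\<forall>i<n. \<forall>j<n. B $$ (p i, p j) =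
           complex_of_real a * (v i * A $$ (i, j) * cnj (v j)) + (if i = j then complex_of_real b else 0)))"
    (is "?L \<longleftrightarrow> ?R")
    if A: "A \<in> carrier_mat n n" and B: "B \<in> carrier_mat n n" for a b :: real
  proof
    assume ?L
    then obtain p v where "a \<noteq> 0" "p permutes {..<n}" "\<forall>i<n. cmod (v i) = 1" and
      "B = complex_of_real a \<cdot>\<^sub>m (monomial_mat n p v * A * mat_adjoint (monomial_mat n p v))
        + complex_of_real b \<cdot>\<^sub>m 1\<^sub>m n"
      unfolding unitary_monomial_mats_def by blast
    then show ?R using entries[OF A B] by blast
  next
    assume ?R
    then obtain p v where a: "a \<noteq> 0" and pv: "p permutes {..<n}" "\<forall>i<n. cmod (v i) = 1" and
      e: "\<forall>i<n. \<forall>j<n. B $$ (p i, p j) =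
           complex_of_real a * (v i * A $$ (i, j) * cnj (v j)) + (if i = j then complex_of_real b else 0)"
      by blast
    have "B = complex_of_real a \<cdot>\<^sub>m (monomial_mat n p v * A * mat_adjoint (monomial_mat n p v))
        + complex_of_real b \<cdot>\<^sub>m 1\<^sub>m n"
      using entries[OF A B pv(1)] e by blast
    moreover have "monomial_mat n p v \<in> unitary_monomial_mats n"
      unfolding unitary_monomial_mats_def using pv by blast
    ultimately show ?L using a by blast
  qed
  show ?thesis
  proof (cases "A \<in> carrier_mat n n \<and> B \<in> carrier_mat n n")
    case True
    then show ?thesis
      unfolding Gamma_equivalent_def Gamma_group_eq_unitary_monomial by (simp only: same)
  next
    case False
    then have "\<not> (hermitian_mat n A \<and> hermitian_mat n B)" unfolding hermitian_mat_def by blast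
    then show ?thesis unfolding Gamma_equivalent_def by blast
  qed
qed

section \<open>Principal submatrices along lists of indices\<close>

lemma poly_char_poly_eq_det:
  assumes A: "(A :: complex mat) \<in> carrier_mat k k"
  shows "poly (char_poly A) x = det (mat k k (\<lambda>(i, j). (if i = j then x else 0) - A $$ (i, j)))"
  unfolding char_poly_def
  by (rule poly_det_cong[of _ k]) (use A in \<open>auto simp: char_poly_matrix_def\<close>)

lemma det_permute_rows_cols:
  assumes A: "(A :: complex mat) \<in> carrier_mat k k" and p: "p permutes {..<k}"
  shows "det (mat k k (\<lambda>(i, j). A $$ (p i, p j))) = det A"
proof -
  have p0: "p permutes {0..<k}" using p by (simp add: atLeast0LessThan)
  define B where "B = transpose_mat (mat k k (\<lambda>(i, j). A $$ (p i, j)))"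
  have B: "B \<in> carrier_mat k k" by (simp add: B_def)
  have "mat k k (\<lambda>(i, j). A $$ (p i, p j)) = transpose_mat (mat k k (\<lambda>(i, j). B $$ (p i, j)))"
    by (rule eq_matI) (auto simp: B_def permutes_less[OF p])
  then have "det (mat k k (\<lambda>(i, j). A $$ (p i, p j))) = det (mat k k (\<lambda>(i, j). B $$ (p i, j)))"
    by (simp add: det_transpose[of _ k])
  also have "\<dots> = signof p * (signof p * det A)"
    unfolding det_permute_rows[OF B p0] by (simp add: B_def det_transpose[of _ k] det_permute_rows[OF A p0])
  also have "\<dots> = det A" by (simp add: sign_def)
  finally show ?thesis .
qed

text \<open>Each term of the Leibniz formula contains every row and every column once, so the phases
  cancel in it and only the affine substitution remains visible. With \<open>a = 1\<close>, \<open>b = 0\<close> and trivial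
  phases, this says that reordering the indices does not change the characteristic polynomial.\<close>

lemma poly_char_poly_monomial_affine:
  assumes M: "M \<in> carrier_mat k k" and N: "N \<in> carrier_mat k k"
    and p: "p permutes {..<k}" and v: "\<And>i. i < k \<Longrightarrow> cmod (v i) = 1" and a: "a \<noteq> 0"
    and entries: "\<And>i j. i < k \<Longrightarrow> j < k \<Longrightarrow>
      N $$ (p i, p j) = a * (v i * M $$ (i, j) * cnj (v j)) + (if i = j then b else 0)"
  shows "poly (char_poly N) x = a ^ k * poly (char_poly M) ((x - b) / a)"
proof -
  define X where "X = mat k k (\<lambda>(i, j). (if i = j then x else 0) - N $$ (i, j))"
  define Y where "Y = mat k k (\<lambda>(i, j). (if i = j then (x - b) / a else 0) - M $$ (i, j))"
  define Z where "Z = mat k k (\<lambda>(i, j). X $$ (p i, p j))"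
  have XY: "Z $$ (i, j) = v i * cnj (v j) * (a * Y $$ (i, j))" if "i < k" "j < k" for i j
    using that a entries[OF that] unit_mult_cnj(1)[OF v, of i]
    by (cases "i = j")
      (simp_all add: X_def Y_def Z_def permutes_less[OF p] permutes_eq_iff[OF p] field_simps)
  have "det X = det Z"
    unfolding Z_def by (rule det_permute_rows_cols[symmetric, OF _ p]) (simp add: X_def)
  also have "\<dots> = (\<Sum>q | q permutes {0..<k}. signof q * (\<Prod>i = 0..<k. Z $$ (i, q i)))"
    by (rule det_def') (simp add: Z_def)
  also have "\<dots> = (\<Sum>q | q permutes {0..<k}. a ^ k * (signof q * (\<Prod>i = 0..<k. Y $$ (i, q i))))"
  proof (intro sum.cong refl)
    fix q assume "q \<in> {q. q permutes {0..<k}}"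
    then have q: "q permutes {0..<k}" by simp
    then have q_less: "q i < k" if "i < k" for i using permutes_less that by (simp add: atLeast0LessThan)
    have "(\<Prod>i = 0..<k. Z $$ (i, q i)) = (\<Prod>i = 0..<k. v i * cnj (v (q i)) * (a * Y $$ (i, q i)))"
      by (intro prod.cong refl) (simp add: XY q_less)
    also have "\<dots> = (\<Prod>i = 0..<k. v i) * (\<Prod>i = 0..<k. cnj (v (q i))) * (a ^ k * (\<Prod>i = 0..<k. Y $$ (i, q i)))"
      by (simp add: prod.distrib)
    also have "(\<Prod>i = 0..<k. cnj (v (q i))) = (\<Prod>i = 0..<k. cnj (v i))"
      by (rule prod.permute[OF q, symmetric, unfolded comp_def])
    also have "(\<Prod>i = 0..<k. v i) * (\<Prod>i = 0..<k. cnj (v i)) = (\<Prod>i = 0..<k. v i * cnj (v i))"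
      by (simp add: prod.distrib)
    also have "\<dots> = 1" by (rule prod.neutral) (use unit_mult_cnj(1) v in auto)
    finally show "signof q * (\<Prod>i = 0..<k. Z $$ (i, q i)) =
        a ^ k * (signof q * (\<Prod>i = 0..<k. Y $$ (i, q i)))" by simp
  qed
  also have "\<dots> = a ^ k * det Y"
    by (subst det_def'[of Y k]) (simp_all add: Y_def sum_distrib_left)
  finally show ?thesis
    unfolding poly_char_poly_eq_det[OF M] poly_char_poly_eq_det[OF N] X_def Y_def .
qed

text \<open>A list instead of a set of indices: relabelling by a permutation becomes \<^const>\<open>map\<close>, and a
  submatrix can be written down with its indices in any order.\<close>

definition principal :: "complex mat \<Rightarrow> nat list \<Rightarrow> complex mat" where
  "principal A xs = mat (length xs) (length xs) (\<lambda>(i, j). A $$ (xs ! i, xs ! j))"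

lemma principal_carrier [simp]: "principal A xs \<in> carrier_mat (length xs) (length xs)"
  by (simp add: principal_def)

lemma principal_index [simp]:
  "i < length xs \<Longrightarrow> j < length xs \<Longrightarrow> principal A xs $$ (i, j) = A $$ (xs ! i, xs ! j)"
  by (simp add: principal_def)

lemma submatrix_eq_principal:
  assumes A: "A \<in> carrier_mat n n" and "\<alpha> \<subseteq> {..<n}"
  shows "submatrix A \<alpha> \<alpha> = principal A (sorted_list_of_set \<alpha>)"
proof -
  have fin: "finite \<alpha>" using assms finite_subset by blast
  have "{i. i < n \<and> i \<in> \<alpha>} = \<alpha>" using assms by auto
  moreover have "pick \<alpha> i = sorted_list_of_set \<alpha> ! i" if "i < card \<alpha>" for i
  proof -
    have "map (pick \<alpha>) [0..<card \<alpha>] = sorted_list_of_set \<alpha>"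
    proof (rule sorted_list_of_set_unique[OF fin, THEN iffD1, symmetric])
      have sorted: "sorted_wrt (<) (map (pick \<alpha>) [0..<card \<alpha>])"
        by (auto simp: sorted_wrt_iff_nth_less pick_mono_le)
      have "set (map (pick \<alpha>) [0..<card \<alpha>]) \<subseteq> \<alpha>"
        by (auto simp: pick_in_set_le)
      moreover have "card (set (map (pick \<alpha>) [0..<card \<alpha>])) = card \<alpha>"
        using sorted distinct_card by (fastforce simp: strict_sorted_iff)
      ultimately have "set (map (pick \<alpha>) [0..<card \<alpha>]) = \<alpha>"
        using fin card_subset_eq by blast
      with sorted show "sorted_wrt (<) (map (pick \<alpha>) [0..<card \<alpha>]) \<and>
          set (map (pick \<alpha>) [0..<card \<alpha>]) = \<alpha> \<and> length (map (pick \<alpha>) [0..<card \<alpha>]) = card \<alpha>"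
        by simp
    qed
    then show ?thesis using that by (metis add_0 diff_zero length_upt nth_map nth_upt)
  qed
  ultimately show ?thesis
    using A by (auto simp: submatrix_def principal_def fin intro!: cong_mat)
qed

lemma char_poly_principal_cong_set:
  assumes "distinct xs" "distinct ys" "set xs = set ys"
  shows "char_poly (principal A xs) = char_poly (principal A ys)"
proof -
  have len: "length ys = length xs" using assms by (metis distinct_card)
  have "mset ys = mset xs" using assms set_eq_iff_mset_eq_distinct by metis
  then obtain p where p: "p permutes {..<length xs}" and ys: "permute_list p xs = ys"
    by (rule mset_eq_permutation)
  have "poly (char_poly (principal A xs)) x = poly (char_poly (principal A ys)) x" for x
  proof -
    have "poly (char_poly (principal A xs)) x
        = 1 ^ length xs * poly (char_poly (principal A ys)) ((x - 0) / 1)"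
    proof (rule poly_char_poly_monomial_affine[OF _ _ p, where v = "\<lambda>_. 1"])
      show "principal A ys \<in> carrier_mat (length xs) (length xs)"
        using principal_carrier[of A ys] by (simp add: len)
    qed (auto simp: len permute_list_nth[OF p] permutes_less[OF p] simp flip: ys)
    then show ?thesis by simp
  qed
  then show ?thesis by (simp add: poly_eq_poly_eq_iff[symmetric] fun_eq_iff)
qed

lemma spectrally_monomorphic_iff_lists:
  assumes A: "A \<in> carrier_mat n n"
  shows "spectrally_monomorphic n k A \<longleftrightarrow>
    (\<forall>xs ys. distinct xs \<longrightarrow> length xs = k \<longrightarrow> set xs \<subseteq> {..<n} \<longrightarrow>
       distinct ys \<longrightarrow> length ys = k \<longrightarrow> set ys \<subseteq> {..<n} \<longrightarrow>
       char_poly (principal A xs) = char_poly (principal A ys))"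
proof -
  have sub: "char_poly (submatrix A (set xs) (set xs)) = char_poly (principal A xs)"
    if "distinct xs" "set xs \<subseteq> {..<n}" for xs
    unfolding submatrix_eq_principal[OF A that(2)]
    by (rule char_poly_principal_cong_set) (use that in auto)
  show ?thesis
  proof
    assume mono: "spectrally_monomorphic n k A"
    show "\<forall>xs ys. distinct xs \<longrightarrow> length xs = k \<longrightarrow> set xs \<subseteq> {..<n} \<longrightarrow>
       distinct ys \<longrightarrow> length ys = k \<longrightarrow> set ys \<subseteq> {..<n} \<longrightarrow>
       char_poly (principal A xs) = char_poly (principal A ys)"
    proof (intro allI impI)
      fix xs ys :: "nat list"
      assume xs: "distinct xs" "length xs = k" "set xs \<subseteq> {..<n}"
        and ys: "distinct ys" "length ys = k" "set ys \<subseteq> {..<n}"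
      have "char_poly (submatrix A (set xs) (set xs)) = char_poly (submatrix A (set ys) (set ys))"
        using mono[unfolded spectrally_monomorphic_def, THEN conjunct2, rule_format, of "set xs" "set ys"]
          xs ys distinct_card[OF xs(1)] distinct_card[OF ys(1)] by simp
      then show "char_poly (principal A xs) = char_poly (principal A ys)"
        using sub xs ys by simp
    qed
  next
    assume lists: "\<forall>xs ys. distinct xs \<longrightarrow> length xs = k \<longrightarrow> set xs \<subseteq> {..<n} \<longrightarrow>
       distinct ys \<longrightarrow> length ys = k \<longrightarrow> set ys \<subseteq> {..<n} \<longrightarrow>
       char_poly (principal A xs) = char_poly (principal A ys)"
    have "char_poly (submatrix A \<alpha> \<alpha>) = char_poly (submatrix A \<beta> \<beta>)"
      if \<alpha>: "\<alpha> \<subseteq> {..<n}" "card \<alpha> = k" and \<beta>: "\<beta> \<subseteq> {..<n}" "card \<beta> = k" for \<alpha> \<beta>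
    proof -
      have "finite \<alpha>" "finite \<beta>" using \<alpha> \<beta> finite_subset by blast+
      then show ?thesis
        unfolding submatrix_eq_principal[OF A \<alpha>(1)] submatrix_eq_principal[OF A \<beta>(1)]
        using lists[rule_format, of "sorted_list_of_set \<alpha>" "sorted_list_of_set \<beta>"] \<alpha> \<beta> by simp
    qed
    then show "spectrally_monomorphic n k A"
      unfolding spectrally_monomorphic_def using A by blast
  qed
qed

text \<open>The transformation of characteristic polynomials depends only on \<open>a\<close>, \<open>b\<close> and the order of
  the submatrix, and it is injective since \<open>a \<noteq> 0\<close>.\<close>

lemma Gamma_equivalent_spectrally_monomorphic:
  assumes "Gamma_equivalent n A B"
  shows "spectrally_monomorphic n k A \<longleftrightarrow> spectrally_monomorphic n k B"
proof -
  obtain a b :: real and p v where a: "a \<noteq> 0" and p: "p permutes {..<n}"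
    and v: "\<forall>i<n. cmod (v i) = 1" and entries: "\<forall>i<n. \<forall>j<n. B $$ (p i, p j) =
      complex_of_real a * (v i * A $$ (i, j) * cnj (v j)) + (if i = j then complex_of_real b else 0)"
    and A: "A \<in> carrier_mat n n" and B: "B \<in> carrier_mat n n"
    using assms unfolding Gamma_equivalent_iff_entries hermitian_mat_def by blast
  have transform: "poly (char_poly (principal B (map p xs))) x =
      complex_of_real a ^ length xs * poly (char_poly (principal A xs)) ((x - of_real b) / of_real a)"
    if xs: "distinct xs" "set xs \<subseteq> {..<n}" for xs x
  proof (rule poly_char_poly_monomial_affine[where p = id and v = "\<lambda>i. v (xs ! i)"])
    have in_range: "xs ! i < n" if "i < length xs" for i using xs that nth_mem by blast
    show "principal B (map p xs) \<in> carrier_mat (length xs) (length xs)"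
      using principal_carrier[of B "map p xs"] by simp
    fix i j assume ij: "i < length xs" "j < length xs"
    show "cmod (v (xs ! i)) = 1" using v in_range ij by blast
    show "principal B (map p xs) $$ (id i, id j) = complex_of_real a * (v (xs ! i) *
        principal A xs $$ (i, j) * cnj (v (xs ! j))) + (if i = j then complex_of_real b else 0)"
      using entries in_range ij nth_eq_iff_index_eq[OF xs(1)] by simp
  qed (use a in \<open>auto simp: permutes_id\<close>)
  have same: "char_poly (principal A xs) = char_poly (principal A ys) \<longleftrightarrow>
      char_poly (principal B (map p xs)) = char_poly (principal B (map p ys))"
    if xs: "distinct xs" "set xs \<subseteq> {..<n}" and ys: "distinct ys" "set ys \<subseteq> {..<n}"
      and len: "length xs = length ys" for xs ys
  proof
    assume "char_poly (principal A xs) = char_poly (principal A ys)"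
    then have "poly (char_poly (principal B (map p xs))) = poly (char_poly (principal B (map p ys)))"
      by (simp add: fun_eq_iff transform xs ys len)
    then show "char_poly (principal B (map p xs)) = char_poly (principal B (map p ys))"
      by (simp add: poly_eq_poly_eq_iff)
  next
    assume eq: "char_poly (principal B (map p xs)) = char_poly (principal B (map p ys))"
    have "poly (char_poly (principal A xs)) x = poly (char_poly (principal A ys)) x" for x
    proof -
      let ?x = "of_real a * x + of_real b"
      have "of_real a ^ length xs * poly (char_poly (principal A xs)) ((?x - of_real b) / of_real a)
          = of_real a ^ length ys * poly (char_poly (principal A ys)) ((?x - of_real b) / of_real a)"
        using transform[OF xs, of ?x] transform[OF ys, of ?x] eq by simp
      then show ?thesis using a len by simp
    qed
    then show "char_poly (principal A xs) = char_poly (principal A ys)"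
      by (simp add: poly_eq_poly_eq_iff[symmetric] fun_eq_iff)
  qed
  have map_p: "distinct (map p xs) \<longleftrightarrow> distinct xs" "set (map p xs) \<subseteq> {..<n} \<longleftrightarrow> set xs \<subseteq> {..<n}" for xs
    using permutes_inj[OF p] permutes_in_image[OF p] by (auto simp: distinct_map inj_on_def inj_def subset_iff)
  have onto: "\<exists>xs. ys = map p xs" for ys
    using permutes_inverses(1)[OF p] by (intro exI[of _ "map (Hilbert_Choice.inv p) ys"]) (simp add: o_def)
  show ?thesis
    unfolding spectrally_monomorphic_iff_lists[OF A] spectrally_monomorphic_iff_lists[OF B]
  proof (intro iffI allI impI)
    fix xs ys :: "nat list"
    assume A_eq: "\<forall>xs ys. distinct xs \<longrightarrow> length xs = k \<longrightarrow> set xs \<subseteq> {..<n} \<longrightarrow>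
       distinct ys \<longrightarrow> length ys = k \<longrightarrow> set ys \<subseteq> {..<n} \<longrightarrow>
       char_poly (principal A xs) = char_poly (principal A ys)"
      and xs: "distinct xs" "length xs = k" "set xs \<subseteq> {..<n}"
      and ys: "distinct ys" "length ys = k" "set ys \<subseteq> {..<n}"
    obtain xs' ys' where [simp]: "xs = map p xs'" "ys = map p ys'" using onto by meson
    have xs': "distinct xs'" "length xs' = k" "set xs' \<subseteq> {..<n}"
      and ys': "distinct ys'" "length ys' = k" "set ys' \<subseteq> {..<n}"
      using xs ys map_p[of xs'] map_p[of ys'] by simp_all
    then show "char_poly (principal B xs) = char_poly (principal B ys)"
      using A_eq[rule_format, OF xs' ys'] same[OF xs'(1,3) ys'(1,3)] by simp
  next
    fix xs ys :: "nat list"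
    assume B_eq: "\<forall>xs ys. distinct xs \<longrightarrow> length xs = k \<longrightarrow> set xs \<subseteq> {..<n} \<longrightarrow>
       distinct ys \<longrightarrow> length ys = k \<longrightarrow> set ys \<subseteq> {..<n} \<longrightarrow>
       char_poly (principal B xs) = char_poly (principal B ys)"
      and xs: "distinct xs" "length xs = k" "set xs \<subseteq> {..<n}"
      and ys: "distinct ys" "length ys = k" "set ys \<subseteq> {..<n}"
    have "char_poly (principal B (map p xs)) = char_poly (principal B (map p ys))"
      by (rule B_eq[rule_format]) (use xs ys map_p in simp_all)
    then show "char_poly (principal A xs) = char_poly (principal A ys)"
      using same[OF xs(1,3) ys(1,3)] xs(2) ys(2) by simp
  qed
qed

section \<open>Weights determined by their sums over small vertex sets\<close>

lemma obtain_fresh: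
  assumes "length xs < card V"
  obtains x where "x \<in> V" "x \<notin> set xs"
proof -
  have "card (set xs) < card V" using assms card_length[of xs] by linarith
  then have "\<not> V \<subseteq> set xs" using card_mono[of "set xs" V] by force
  then show thesis using that by blast
qed

lemma card_Diff_pair_ge: "card V \<ge> k + 2 \<Longrightarrow> card (V - {c, d}) \<ge> k"
proof -
  assume "card V \<ge> k + 2"
  moreover have "card {c, d} \<le> 2" by (cases "c = d") auto
  ultimately show ?thesis using diff_card_le_card_Diff[of "{c, d}" V] by simp
qed

lemma vertex_weight_from_triple_sums:
  fixes f :: "'a \<Rightarrow> 'b::field_char_0"
  assumes "card V \<ge> 4" "a \<in> V"
    and sums: "\<And>a b c. \<lbrakk>a \<in> V; b \<in> V; c \<in> V; distinct [a, b, c]\<rbrakk> \<Longrightarrow> f a + f b + f c = K"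
  shows "3 * f a = K"
proof -
  obtain b where b: "b \<in> V" "b \<notin> set [a]" by (rule obtain_fresh[of "[a]" V]) (use assms in auto)
  obtain c where c: "c \<in> V" "c \<notin> set [a, b]" by (rule obtain_fresh[of "[a, b]" V]) (use assms in auto)
  obtain d where d: "d \<in> V" "d \<notin> set [a, b, c]" by (rule obtain_fresh[of "[a, b, c]" V]) (use assms in auto)
  have "f a + f b + f c = K" "f a + f b + f d = K" "f a + f c + f d = K" "f b + f c + f d = K"
    by (rule sums; use assms b c d in auto)+
  moreover have "3 * f a = (f a + f b + f c) + (f a + f b + f d) + (f a + f c + f d)
      - 2 * (f b + f c + f d)"
    by (simp add: algebra_simps)
  ultimately show ?thesis by simp
qed

text \<open>Exchanging \<open>c\<close> for \<open>d\<close> in a triangle \<open>{x, y, c}\<close> shows that \<open>f x = w x c - w x d\<close> satisfies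
  \<open>f x + f y = 0\<close> for all \<open>x \<noteq> y\<close> outside \<open>{c, d}\<close>. Three such vertices exist, so \<open>f\<close> vanishes.\<close>

lemma edge_weight_from_triangle_sums:
  fixes w :: "'a \<Rightarrow> 'a \<Rightarrow> 'b::field_char_0"
  assumes V: "card V \<ge> 5" and sym: "\<And>a b. w a b = w b a"
    and sums: "\<And>a b c. \<lbrakk>a \<in> V; b \<in> V; c \<in> V; distinct [a, b, c]\<rbrakk> \<Longrightarrow> w a b + w a c + w b c = K"
    and ab: "a \<in> V" "b \<in> V" "a \<noteq> b"
  shows "3 * w a b = K"
proof -
  have swap: "w a c = w a d" if "a \<in> V" "c \<in> V" "d \<in> V" "distinct [a, c, d]" for a c d
  proof -
    obtain b where b: "b \<in> V" "b \<notin> set [a, c, d]" by (rule obtain_fresh[of "[a, c, d]" V]) (use V in auto)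
    obtain e where e: "e \<in> V" "e \<notin> set [a, b, c, d]" by (rule obtain_fresh[of "[a, b, c, d]" V]) (use V in auto)
    have opp: "(w x c - w x d) + (w y c - w y d) = 0"
      if "x \<in> V" "y \<in> V" "distinct [x, y, c, d]" for x y
    proof -
      have "w x y + w x c + w y c = K" "w x y + w x d + w y d = K"
        by (rule sums; use that \<open>c \<in> V\<close> \<open>d \<in> V\<close> in auto)+
      then have "(w x y + w x c + w y c) - (w x y + w x d + w y d) = 0" by simp
      then show ?thesis by (simp add: algebra_simps)
    qed
    have "(w a c - w a d) + (w b c - w b d) = 0" "(w a c - w a d) + (w e c - w e d) = 0"
      "(w b c - w b d) + (w e c - w e d) = 0"
      by (rule opp; use that b e in auto)+
    moreover have "2 * (w a c - w a d) = ((w a c - w a d) + (w b c - w b d))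
        + ((w a c - w a d) + (w e c - w e d)) - ((w b c - w b d) + (w e c - w e d))"
      by (simp add: algebra_simps)
    ultimately have "2 * (w a c - w a d) = 0" by simp
    then show ?thesis by simp
  qed
  obtain c where c: "c \<in> V" "c \<notin> set [a, b]" by (rule obtain_fresh[of "[a, b]" V]) (use V in auto)
  have "w a c = w a b" by (rule swap) (use ab c in auto)
  moreover have "w b c = w b a" by (rule swap) (use ab c in auto)
  moreover have "w a b + w a c + w b c = K" by (rule sums) (use ab c in auto)
  ultimately show ?thesis using sym[of a b] by simp
qed

text \<open>The same exchange, now with \<open>f x + f y + f z = 0\<close> for all triples outside \<open>{c, d}\<close>.\<close>

lemma edge_weight_from_4_set_sums:
  fixes w :: "'a \<Rightarrow> 'a \<Rightarrow> 'b::field_char_0"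
  assumes V: "card V \<ge> 6" and sym: "\<And>a b. w a b = w b a"
    and sums: "\<And>a b c d. \<lbrakk>a \<in> V; b \<in> V; c \<in> V; d \<in> V; distinct [a, b, c, d]\<rbrakk> \<Longrightarrow>
      w a b + w a c + w a d + w b c + w b d + w c d = K"
    and ab: "a \<in> V" "b \<in> V" "a \<noteq> b"
  shows "6 * w a b = K"
proof -
  have swap: "w a c = w a d" if acd: "a \<in> V" "c \<in> V" "d \<in> V" "distinct [a, c, d]" for a c d
  proof -
    have "3 * (w a c - w a d) = 0"
    proof (rule vertex_weight_from_triple_sums[where V = "V - {c, d}" and f = "\<lambda>x. w x c - w x d"])
      show "card (V - {c, d}) \<ge> 4" by (rule card_Diff_pair_ge) (use V in simp)
      fix x y z assume xyz: "x \<in> V - {c, d}" "y \<in> V - {c, d}" "z \<in> V - {c, d}" "distinct [x, y, z]"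
      have "w x y + w x z + w x c + w y z + w y c + w z c = K"
        "w x y + w x z + w x d + w y z + w y d + w z d = K"
        by (rule sums; use xyz acd in auto)+
      then have "(w x y + w x z + w x c + w y z + w y c + w z c)
          - (w x y + w x z + w x d + w y z + w y d + w z d) = 0" by simp
      then show "(w x c - w x d) + (w y c - w y d) + (w z c - w z d) = 0"
        by (simp add: algebra_simps)
    qed (use acd in auto)
    then show ?thesis by simp
  qed
  obtain c where c: "c \<in> V" "c \<notin> set [a, b]" by (rule obtain_fresh[of "[a, b]" V]) (use V in auto)
  obtain d where d: "d \<in> V" "d \<notin> set [a, b, c]" by (rule obtain_fresh[of "[a, b, c]" V]) (use V in auto)
  have "w a c = w a b" by (rule swap) (use ab c in auto)
  moreover have "w a d = w a b" by (rule swap) (use ab d in auto)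
  moreover have "w b c = w b a" by (rule swap) (use ab c in auto)
  moreover have "w b d = w b a" by (rule swap) (use ab d in auto)
  moreover have "w c d = w c a" by (rule swap) (use ab c d in auto)
  moreover have "w a b + w a c + w a d + w b c + w b d + w c d = K"
    by (rule sums) (use ab c d in auto)
  ultimately show ?thesis using sym[of a b] sym[of a c] by simp
qed

text \<open>Exchanging \<open>c\<close> for \<open>d\<close> leaves an edge weight \<open>t x y c - t x y d\<close> on the remaining vertices, at
  least five, whose triangle sums vanish.\<close>

lemma triangle_weight_from_4_set_sums:
  fixes t :: "'a \<Rightarrow> 'a \<Rightarrow> 'a \<Rightarrow> 'b::field_char_0"
  assumes V: "card V \<ge> 7" and sym: "\<And>a b c. t a b c = t b a c" "\<And>a b c. t a b c = t a c b"
    and sums: "\<And>a b c d. \<lbrakk>a \<in> V; b \<in> V; c \<in> V; d \<in> V; distinct [a, b, c, d]\<rbrakk> \<Longrightarrow>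
      t a b c + t a b d + t a c d + t b c d = K"
    and abc: "a \<in> V" "b \<in> V" "c \<in> V" "distinct [a, b, c]"
  shows "4 * t a b c = K"
proof -
  have swap: "t a b c = t a b d"
    if abcd: "a \<in> V" "b \<in> V" "c \<in> V" "d \<in> V" "distinct [a, b, c, d]" for a b c d
  proof -
    have "3 * (t a b c - t a b d) = 0"
    proof (rule edge_weight_from_triangle_sums[where V = "V - {c, d}" and w = "\<lambda>x y. t x y c - t x y d"])
      show "card (V - {c, d}) \<ge> 5" by (rule card_Diff_pair_ge) (use V in simp)
      show "t x y c - t x y d = t y x c - t y x d" for x y using sym(1) by metis
      fix x y z assume xyz: "x \<in> V - {c, d}" "y \<in> V - {c, d}" "z \<in> V - {c, d}" "distinct [x, y, z]"
      have "t x y z + t x y c + t x z c + t y z c = K"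
        "t x y z + t x y d + t x z d + t y z d = K"
        by (rule sums; use xyz abcd in auto)+
      then have "(t x y z + t x y c + t x z c + t y z c)
          - (t x y z + t x y d + t x z d + t y z d) = 0" by simp
      then show "(t x y c - t x y d) + (t x z c - t x z d) + (t y z c - t y z d) = 0"
        by (simp add: algebra_simps)
    qed (use abcd in auto)
    then show ?thesis by simp
  qed
  obtain d where d: "d \<in> V" "d \<notin> set [a, b, c]" by (rule obtain_fresh[of "[a, b, c]" V]) (use V in auto)
  have "t a b c = t a b d" by (rule swap) (use abc d in auto)
  moreover have "t a c d = t a c b" by (rule swap) (use abc d in auto)
  moreover have "t b c d = t b c a" by (rule swap) (use abc d in auto)
  moreover have "t a b c + t a b d + t a c d + t b c d = K" by (rule sums) (use abc d in auto)
  moreover have "t a c b = t a b c" "t b c a = t a b c" using sym by metis+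
  ultimately show ?thesis by simp
qed


section \<open>Characteristic polynomials of orders three and four\<close>

lemma det_mat_Suc:
  "det (mat (Suc k) (Suc k) f) =
    (\<Sum>j<Suc k. f (0, j) * ((-1) ^ j * det (mat k k (\<lambda>(a, b). f (Suc a, if b < j then b else Suc b)))))"
  for f :: "nat \<times> nat \<Rightarrow> 'a::comm_ring_1"
proof -
  have "mat_delete (mat (Suc k) (Suc k) f) 0 j
      = mat k k (\<lambda>(a, b). f (Suc a, if b < j then b else Suc b))" if "j < Suc k" for j
    using that by (intro eq_matI) (auto simp: mat_delete_def)
  then show ?thesis
    by (subst laplace_expansion_row[of _ "Suc k" 0]) (auto simp: cofactor_def intro!: sum.cong)
qed

lemma det_mat_0: "det (mat 0 0 f) = (1::'a::comm_ring_1)"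
  by (rule det_dim_zero) simp

lemma det_mat_3: "det (mat (Suc (Suc (Suc 0))) (Suc (Suc (Suc 0))) f) =
  f (0,0) * (f (1,1) * f (2,2) - f (1,2) * f (2,1))
  - f (0,1) * (f (1,0) * f (2,2) - f (1,2) * f (2,0))
  + f (0,2) * (f (1,0) * f (2,1) - f (1,1) * f (2,0))"
  for f :: "nat \<times> nat \<Rightarrow> 'a::comm_ring_1"
  by (simp add: det_mat_Suc det_mat_0 lessThan_Suc numeral_2_eq_2, simp add: algebra_simps)

lemma det_mat_4: "det (mat (Suc (Suc (Suc (Suc 0)))) (Suc (Suc (Suc (Suc 0)))) f) =
  f (0,0) * (f (1,1) * (f (2,2) * f (3,3) - f (2,3) * f (3,2))
    - f (1,2) * (f (2,1) * f (3,3) - f (2,3) * f (3,1))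
    + f (1,3) * (f (2,1) * f (3,2) - f (2,2) * f (3,1)))
  - f (0,1) * (f (1,0) * (f (2,2) * f (3,3) - f (2,3) * f (3,2))
    - f (1,2) * (f (2,0) * f (3,3) - f (2,3) * f (3,0))
    + f (1,3) * (f (2,0) * f (3,2) - f (2,2) * f (3,0)))
  + f (0,2) * (f (1,0) * (f (2,1) * f (3,3) - f (2,3) * f (3,1))
    - f (1,1) * (f (2,0) * f (3,3) - f (2,3) * f (3,0))
    + f (1,3) * (f (2,0) * f (3,1) - f (2,1) * f (3,0)))
  - f (0,3) * (f (1,0) * (f (2,1) * f (3,2) - f (2,2) * f (3,1))
    - f (1,1) * (f (2,0) * f (3,2) - f (2,2) * f (3,0))
    + f (1,2) * (f (2,0) * f (3,1) - f (2,1) * f (3,0)))"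
  for f :: "nat \<times> nat \<Rightarrow> 'a::comm_ring_1"
  by (subst det_mat_Suc)
    (simp add: det_mat_3 lessThan_Suc numeral_2_eq_2 numeral_3_eq_3, simp add: algebra_simps)

text \<open>For a Hermitian matrix these are \<open>|h_ij|^2\<close> and twice the real parts of the products along a
  triangle and along a closed walk of length four. Written without conjugates, they collect the
  contributions of the transpositions, \<open>3\<close>-cycles and \<open>4\<close>-cycles to the determinant of any
  matrix.\<close>

definition edge_weight :: "complex mat \<Rightarrow> nat \<Rightarrow> nat \<Rightarrow> complex" where
  "edge_weight A i j = A $$ (i,j) * A $$ (j,i)"

definition triangle_weight :: "complex mat \<Rightarrow> nat \<Rightarrow> nat \<Rightarrow> nat \<Rightarrow> complex" where
  "triangle_weight A i j k =
     A $$ (i,j) * A $$ (j,k) * A $$ (k,i) + A $$ (i,k) * A $$ (k,j) * A $$ (j,i)"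

definition square_weight :: "complex mat \<Rightarrow> nat \<Rightarrow> nat \<Rightarrow> nat \<Rightarrow> nat \<Rightarrow> complex" where
  "square_weight A i j k l =
     A $$ (i,j) * A $$ (j,k) * A $$ (k,l) * A $$ (l,i) + A $$ (i,l) * A $$ (l,k) * A $$ (k,j) * A $$ (j,i)"

lemma poly_char_poly_principal_3:
  "poly (char_poly (principal A [a, b, c])) x =
     (x - A $$ (a,a)) * (x - A $$ (b,b)) * (x - A $$ (c,c))
     - (x - A $$ (a,a)) * edge_weight A b c - (x - A $$ (b,b)) * edge_weight A a c
     - (x - A $$ (c,c)) * edge_weight A a b
     - triangle_weight A a b c"
proof -
  have P: "principal A [a, b, c] \<in> carrier_mat (Suc (Suc (Suc 0))) (Suc (Suc (Suc 0)))"
    using principal_carrier[of A "[a, b, c]"] by simp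
  show ?thesis
    unfolding poly_char_poly_eq_det[OF P] det_mat_3 edge_weight_def triangle_weight_def
    by (simp add: algebra_simps)
qed

lemma poly_char_poly_principal_4:
  "poly (char_poly (principal A [a, b, c, d])) x =
     (x - A $$ (a,a)) * (x - A $$ (b,b)) * (x - A $$ (c,c)) * (x - A $$ (d,d))
     - (x - A $$ (a,a)) * (x - A $$ (b,b)) * edge_weight A c d
     - (x - A $$ (a,a)) * (x - A $$ (c,c)) * edge_weight A b d
     - (x - A $$ (a,a)) * (x - A $$ (d,d)) * edge_weight A b c
     - (x - A $$ (b,b)) * (x - A $$ (c,c)) * edge_weight A a d
     - (x - A $$ (b,b)) * (x - A $$ (d,d)) * edge_weight A a c
     - (x - A $$ (c,c)) * (x - A $$ (d,d)) * edge_weight A a b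
     - (x - A $$ (a,a)) * triangle_weight A b c d
     - (x - A $$ (b,b)) * triangle_weight A a c d
     - (x - A $$ (c,c)) * triangle_weight A a b d
     - (x - A $$ (d,d)) * triangle_weight A a b c
     + edge_weight A a b * edge_weight A c d + edge_weight A a c * edge_weight A b d
     + edge_weight A a d * edge_weight A b c
     - square_weight A a b c d - square_weight A a b d c - square_weight A a c b d"
proof -
  have P: "principal A [a, b, c, d] \<in> carrier_mat (Suc (Suc (Suc (Suc 0)))) (Suc (Suc (Suc (Suc 0))))"
    using principal_carrier[of A "[a, b, c, d]"] by simp
  show ?thesis
    unfolding poly_char_poly_eq_det[OF P] det_mat_4 edge_weight_def triangle_weight_def
      square_weight_def
    by (simp, simp add: algebra_simps)
qed

lemma edge_weight_sym: "edge_weight A i j = edge_weight A j i"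
  by (simp add: edge_weight_def mult.commute)

lemma triangle_weight_sym:
  "triangle_weight A i j k = triangle_weight A j i k" "triangle_weight A i j k = triangle_weight A i k j"
  by (simp_all add: triangle_weight_def algebra_simps)

lemma poly_char_poly_principal_3_const_diag:
  assumes "A $$ (a,a) = d" "A $$ (b,b) = d" "A $$ (c,c) = d"
  shows "poly (char_poly (principal A [a, b, c])) x =
     poly [:- triangle_weight A a b c,
            - (edge_weight A a b + edge_weight A a c + edge_weight A b c), 0, 1:] (x - d)"
  unfolding poly_char_poly_principal_3 assms
  by (simp add: algebra_simps)

lemma poly_char_poly_principal_4_const_diag:
  assumes "A $$ (a,a) = \<delta>" "A $$ (b,b) = \<delta>" "A $$ (c,c) = \<delta>" "A $$ (d,d) = \<delta>"
  shows "poly (char_poly (principal A [a, b, c, d])) x =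
     poly [:edge_weight A a b * edge_weight A c d + edge_weight A a c * edge_weight A b d
             + edge_weight A a d * edge_weight A b c
             - square_weight A a b c d - square_weight A a b d c - square_weight A a c b d,
            - (triangle_weight A a b c + triangle_weight A a b d + triangle_weight A a c d
                + triangle_weight A b c d),
            - (edge_weight A a b + edge_weight A a c + edge_weight A a d + edge_weight A b c
                + edge_weight A b d + edge_weight A c d), 0, 1:] (x - \<delta>)"
proof -
  have ring: "y * y * y * y - y * y * cd - y * y * bd - y * y * bc - y * y * ad - y * y * ac - y * y * ab
      - y * bcd - y * acd - y * abd - y * abc + e1 + e2 + e3 - s1 - s2 - s3
    = poly [:e1 + e2 + e3 - s1 - s2 - s3, - (abc + abd + acd + bcd),
        - (ab + ac + ad + bc + bd + cd), 0, 1:] y"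
    for y ab ac ad bc bd cd abc abd acd bcd e1 e2 e3 s1 s2 s3 :: complex
    by (simp add: algebra_simps)
  show ?thesis
    unfolding poly_char_poly_principal_4 assms
    by (rule ring)
qed

text \<open>The second difference of a monic cubic \<open>x^3 - s x^2 + \<dots>\<close> at \<open>0\<close> is \<open>6 - 2 s\<close>. This
  reads off the trace without naming the remaining coefficients.\<close>

lemma diagonal_sum_3:
  "2 * (A $$ (a,a) + A $$ (b,b) + A $$ (c,c)) = 6 - (let f = poly (char_poly (principal A [a, b, c]))
     in f 2 - 2 * f 1 + f 0)"
  unfolding poly_char_poly_principal_3 Let_def by (simp add: algebra_simps)

text \<open>Likewise, the third difference of \<open>x^4 - s x^3 + \<dots>\<close> at \<open>0\<close> is \<open>36 - 6 s\<close>.\<close>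

lemma diagonal_sum_4:
  "6 * (A $$ (a,a) + A $$ (b,b) + A $$ (c,c) + A $$ (d,d)) = 36 - (let f = poly (char_poly (principal A [a, b, c, d]))
     in f 3 - 3 * f 2 + 3 * f 1 - f 0)"
proof -
  have ring: "6 * (a + b + c + d) = 36 - (f 3 - 3 * f 2 + 3 * f 1 - f (0::complex))"
    if "\<And>x. f x = (x - a) * (x - b) * (x - c) * (x - d)
      - (x - a) * (x - b) * w1 - (x - a) * (x - c) * w2
     - (x - a) * (x - d) * w3 - (x - b) * (x - c) * w4
     - (x - b) * (x - d) * w5 - (x - c) * (x - d) * w6
     - (x - a) * t1 - (x - b) * t2 - (x - c) * t3 - (x - d) * t4 + e1 + e2 + e3 - s1 - s2 - s3"
    for f a b c d w1 w2 w3 w4 w5 w6 t1 t2 t3 t4 e1 e2 e3 s1 s2 s3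
    unfolding that by (simp add: algebra_simps)
  show ?thesis
    unfolding Let_def by (rule ring) (rule poly_char_poly_principal_4)
qed

lemma poly_shift_inject:
  fixes p q :: "complex poly"
  assumes "\<And>x. poly p (x - d) = poly q (x - d)"
  shows "p = q"
proof -
  have "poly p x = poly q x" for x using assms[of "x + d"] by simp
  then show ?thesis by (simp add: poly_eq_poly_eq_iff[symmetric] fun_eq_iff)
qed

text \<open>First the trace makes the diagonal constant; after the shift by its value \<open>\<delta>\<close> the
  other coefficients are sums of edge and triangle weights.\<close>

lemma spectrally_monomorphic_3_weights:
  assumes n: "n \<ge> 5" and mono: "spectrally_monomorphic n 3 A"
  obtains \<delta> w \<tau> where "\<And>i. i < n \<Longrightarrow> A $$ (i,i) = \<delta>"
    "\<And>i j. \<lbrakk>i < n; j < n; i \<noteq> j\<rbrakk> \<Longrightarrow> edge_weight A i j = w"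
    "\<And>i j k. \<lbrakk>i < n; j < n; k < n; distinct [i, j, k]\<rbrakk> \<Longrightarrow> triangle_weight A i j k = \<tau>"
proof -
  have A: "A \<in> carrier_mat n n" using mono unfolding spectrally_monomorphic_def by blast
  have eq: "char_poly (principal A [a, b, c]) = char_poly (principal A [0, 1, 2])"
    if "a < n" "b < n" "c < n" "distinct [a, b, c]" for a b c
    by (rule mono[unfolded spectrally_monomorphic_iff_lists[OF A], rule_format])
      (use that n in auto)
  define \<delta> where "\<delta> = (6 - (let f = poly (char_poly (principal A [0, 1, 2])) in f 2 - 2 * f 1 + f 0)) / 6"
  have diag: "A $$ (i,i) = \<delta>" if "i < n" for i
  proof -
    have "3 * A $$ (i,i) = 3 * \<delta>"
    proof (rule vertex_weight_from_triple_sums[where V = "{..<n}" and f = "\<lambda>i. A $$ (i,i)"])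
      fix a b c assume "a \<in> {..<n}" "b \<in> {..<n}" "c \<in> {..<n}" "distinct [a, b, c]"
      then have "char_poly (principal A [a, b, c]) = char_poly (principal A [0, 1, 2])"
        using eq by blast
      then have "2 * (A $$ (a,a) + A $$ (b,b) + A $$ (c,c)) = 2 * (3 * \<delta>)"
        unfolding diagonal_sum_3 \<delta>_def by simp
      then show "A $$ (a,a) + A $$ (b,b) + A $$ (c,c) = 3 * \<delta>" by (simp only: mult_cancel_left) simp
    qed (use n that in auto)
    then show ?thesis by simp
  qed
  have coeffs: "[:- triangle_weight A a b c,
        - (edge_weight A a b + edge_weight A a c + edge_weight A b c), 0, 1:]
      = [:- triangle_weight A 0 1 2,
        - (edge_weight A 0 1 + edge_weight A 0 2 + edge_weight A 1 2), 0, 1:]"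
    if abc: "a < n" "b < n" "c < n" "distinct [a, b, c]" for a b c
  proof (rule poly_shift_inject[of _ \<delta>])
    fix x
    have "poly (char_poly (principal A [a, b, c])) x = poly (char_poly (principal A [0, 1, 2])) x"
      using eq[OF abc] by simp
    moreover have "A $$ (0,0) = \<delta>" "A $$ (1,1) = \<delta>" "A $$ (2,2) = \<delta>" using diag n by auto
    ultimately show "poly [:- triangle_weight A a b c,
        - (edge_weight A a b + edge_weight A a c + edge_weight A b c), 0, 1:] (x - \<delta>)
      = poly [:- triangle_weight A 0 1 2,
        - (edge_weight A 0 1 + edge_weight A 0 2 + edge_weight A 1 2), 0, 1:] (x - \<delta>)"
      using diag abc by (simp only: poly_char_poly_principal_3_const_diag)
  qed
  show thesis
  proof
    show "A $$ (i,i) = \<delta>" if "i < n" for i using diag that .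
    show "edge_weight A i j = (edge_weight A 0 1 + edge_weight A 0 2 + edge_weight A 1 2) / 3"
      if "i < n" "j < n" "i \<noteq> j" for i j
    proof -
      have "3 * edge_weight A i j = edge_weight A 0 1 + edge_weight A 0 2 + edge_weight A 1 2"
      proof (rule edge_weight_from_triangle_sums[where V = "{..<n}"])
        fix a b c assume "a \<in> {..<n}" "b \<in> {..<n}" "c \<in> {..<n}" "distinct [a, b, c]"
        then have "a < n" "b < n" "c < n" "distinct [a, b, c]" by simp_all
        from coeffs[OF this] show "edge_weight A a b + edge_weight A a c + edge_weight A b c
            = edge_weight A 0 1 + edge_weight A 0 2 + edge_weight A 1 2"
          by (simp only: pCons_eq_iff neg_equal_iff_equal)
      qed (use n that edge_weight_sym in auto)
      then show ?thesis by (simp add: field_simps)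
    qed
    show "triangle_weight A i j k = triangle_weight A 0 1 2"
      if "i < n" "j < n" "k < n" "distinct [i, j, k]" for i j k
      using coeffs[OF that] by (simp only: pCons_eq_iff neg_equal_iff_equal)
  qed
qed

text \<open>Here the constant coefficient becomes usable as well: its products of edge weights are
  constant, so the sum of the three square weights is constant.\<close>

lemma spectrally_monomorphic_4_weights:
  assumes n: "n \<ge> 7" and mono: "spectrally_monomorphic n 4 A"
  obtains \<delta> w \<tau> \<sigma> where "\<And>i. i < n \<Longrightarrow> A $$ (i,i) = \<delta>"
    "\<And>i j. \<lbrakk>i < n; j < n; i \<noteq> j\<rbrakk> \<Longrightarrow> edge_weight A i j = w"
    "\<And>i j k. \<lbrakk>i < n; j < n; k < n; distinct [i, j, k]\<rbrakk> \<Longrightarrow> triangle_weight A i j k = \<tau>"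
    "\<And>i j k l. \<lbrakk>i < n; j < n; k < n; l < n; distinct [i, j, k, l]\<rbrakk> \<Longrightarrow>
       square_weight A i j k l + square_weight A i j l k + square_weight A i k j l = \<sigma>"
proof -
  have A: "A \<in> carrier_mat n n" using mono unfolding spectrally_monomorphic_def by blast
  have eq: "char_poly (principal A [a, b, c, d]) = char_poly (principal A [0, 1, 2, 3])"
    if "a < n" "b < n" "c < n" "d < n" "distinct [a, b, c, d]" for a b c d
    by (rule mono[unfolded spectrally_monomorphic_iff_lists[OF A], rule_format])
      (use that n in auto)
  define K where "K = A $$ (0,0) + A $$ (1,1) + A $$ (2,2) + A $$ (3,3)"
  have diag_sum: "A $$ (a,a) + A $$ (b,b) + A $$ (c,c) + A $$ (d,d) = K"
    if "a < n" "b < n" "c < n" "d < n" "distinct [a, b, c, d]" for a b c d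
  proof -
    have "6 * (A $$ (a,a) + A $$ (b,b) + A $$ (c,c) + A $$ (d,d)) = 6 * K"
      unfolding K_def diagonal_sum_4 eq[OF that] ..
    then show ?thesis by (simp only: mult_cancel_left) simp
  qed
  have diag: "A $$ (i,i) = A $$ (0,0)" if "i < n" for i
  proof (cases "i = 0")
    case False
    obtain a where a: "a < n" "a \<noteq> 0" "a \<noteq> i" by (rule obtain_fresh[of "[0, i]" "{..<n}"]) (use n in auto)
    obtain b where b: "b < n" "b \<noteq> 0" "b \<noteq> i" "b \<noteq> a" by (rule obtain_fresh[of "[0, i, a]" "{..<n}"]) (use n in auto)
    obtain c where c: "c < n" "c \<noteq> 0" "c \<noteq> i" "c \<noteq> a" "c \<noteq> b" by (rule obtain_fresh[of "[0, i, a, b]" "{..<n}"]) (use n in auto)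
    have "A $$ (i,i) + A $$ (a,a) + A $$ (b,b) + A $$ (c,c) = K"
      "A $$ (0,0) + A $$ (a,a) + A $$ (b,b) + A $$ (c,c) = K"
      by (rule diag_sum; use that n a b c in auto)+
    then show ?thesis by (metis add_right_cancel)
  qed simp
  define E where "E = (\<lambda>a b c d. edge_weight A a b * edge_weight A c d + edge_weight A a c * edge_weight A b d
             + edge_weight A a d * edge_weight A b c
             - square_weight A a b c d - square_weight A a b d c - square_weight A a c b d)"
  define T where "T = (\<lambda>a b c d. triangle_weight A a b c + triangle_weight A a b d
      + triangle_weight A a c d + triangle_weight A b c d)"
  define W where "W = (\<lambda>a b c d. edge_weight A a b + edge_weight A a c + edge_weight A a d
      + edge_weight A b c + edge_weight A b d + edge_weight A c d)"
  have coeffs: "[:E a b c d, - T a b c d, - W a b c d, 0, 1:] = [:E 0 1 2 3, - T 0 1 2 3, - W 0 1 2 3, 0, 1:]"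
    if abcd: "a < n" "b < n" "c < n" "d < n" "distinct [a, b, c, d]" for a b c d
  proof (rule poly_shift_inject[of _ "A $$ (0,0)"])
    fix x
    have *: "poly (char_poly (principal A [i, j, k, l])) x
        = poly [:E i j k l, - T i j k l, - W i j k l, 0, 1:] (x - A $$ (0,0))"
      if "i < n" "j < n" "k < n" "l < n" for i j k l
      unfolding E_def T_def W_def
      by (rule poly_char_poly_principal_4_const_diag) (rule diag[OF that(1)] diag[OF that(2)] diag[OF that(3)] diag[OF that(4)])+
    have "poly [:E a b c d, - T a b c d, - W a b c d, 0, 1:] (x - A $$ (0,0))
        = poly (char_poly (principal A [0, 1, 2, 3])) x"
      using eq[OF abcd] *[OF abcd(1-4)] by simp
    also have "\<dots> = poly [:E 0 1 2 3, - T 0 1 2 3, - W 0 1 2 3, 0, 1:] (x - A $$ (0,0))"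
      by (rule *) (use n in auto)
    finally show "poly [:E a b c d, - T a b c d, - W a b c d, 0, 1:] (x - A $$ (0,0))
        = poly [:E 0 1 2 3, - T 0 1 2 3, - W 0 1 2 3, 0, 1:] (x - A $$ (0,0))" .
  qed
  then have E: "E a b c d = E 0 1 2 3" and T: "T a b c d = T 0 1 2 3" and W: "W a b c d = W 0 1 2 3"
    if "a < n" "b < n" "c < n" "d < n" "distinct [a, b, c, d]" for a b c d
    using that by (simp_all only: pCons_eq_iff neg_equal_iff_equal)
  have edges: "edge_weight A i j = W 0 1 2 3 / 6" if "i < n" "j < n" "i \<noteq> j" for i j
  proof -
    have "6 * edge_weight A i j = W 0 1 2 3"
    proof (rule edge_weight_from_4_set_sums[where V = "{..<n}"])
      fix a b c d assume "a \<in> {..<n}" "b \<in> {..<n}" "c \<in> {..<n}" "d \<in> {..<n}" "distinct [a, b, c, d]"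
      then have "a < n" "b < n" "c < n" "d < n" "distinct [a, b, c, d]" by simp_all
      from W[OF this] show "edge_weight A a b + edge_weight A a c + edge_weight A a d
          + edge_weight A b c + edge_weight A b d + edge_weight A c d = W 0 1 2 3"
        unfolding W_def .
    qed (use n that edge_weight_sym in auto)
    then show ?thesis by (simp add: field_simps)
  qed
  show thesis
  proof
    show "A $$ (i,i) = A $$ (0,0)" if "i < n" for i using diag that .
    show "edge_weight A i j = W 0 1 2 3 / 6" if "i < n" "j < n" "i \<noteq> j" for i j
      using edges that .
    show "triangle_weight A i j k = T 0 1 2 3 / 4"
      if "i < n" "j < n" "k < n" "distinct [i, j, k]" for i j k
    proof -
      have "4 * triangle_weight A i j k = T 0 1 2 3"
      proof (rule triangle_weight_from_4_set_sums[where V = "{..<n}"])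
        fix a b c d assume "a \<in> {..<n}" "b \<in> {..<n}" "c \<in> {..<n}" "d \<in> {..<n}" "distinct [a, b, c, d]"
        then have "a < n" "b < n" "c < n" "d < n" "distinct [a, b, c, d]" by simp_all
        from T[OF this] show "triangle_weight A a b c + triangle_weight A a b d
            + triangle_weight A a c d + triangle_weight A b c d = T 0 1 2 3"
          unfolding T_def .
      next
        show "triangle_weight A a b c = triangle_weight A b a c" for a b c by (rule triangle_weight_sym)
        show "triangle_weight A a b c = triangle_weight A a c b" for a b c by (rule triangle_weight_sym)
      qed (use n that in auto)
      then show ?thesis by (simp add: field_simps)
    qed
    show "square_weight A i j k l + square_weight A i j l k + square_weight A i k j l
        = 3 * (W 0 1 2 3 / 6)\<^sup>2 - E 0 1 2 3"
      if ijkl: "i < n" "j < n" "k < n" "l < n" "distinct [i, j, k, l]" for i j k l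
    proof -
      have e: "edge_weight A i j = W 0 1 2 3 / 6" "edge_weight A i k = W 0 1 2 3 / 6"
        "edge_weight A i l = W 0 1 2 3 / 6" "edge_weight A j k = W 0 1 2 3 / 6"
        "edge_weight A j l = W 0 1 2 3 / 6" "edge_weight A k l = W 0 1 2 3 / 6"
        by (rule edges; use ijkl in simp)+
      then show ?thesis
        unfolding E[OF ijkl, symmetric] unfolding E_def e by (simp add: power2_eq_square)
    qed
  qed
qed

section \<open>Hermitian matrices in normal form\<close>

lemma hermitian_mat_cnj:
  "\<lbrakk>hermitian_mat n H; i < n; j < n\<rbrakk> \<Longrightarrow> H $$ (j, i) = cnj (H $$ (i, j))"
  unfolding hermitian_mat_def using mat_adjoint_index[of H n j i] by simp

lemma hermitian_matI:
  assumes A: "A \<in> carrier_mat n n" and herm: "\<And>i j. i < n \<Longrightarrow> j < n \<Longrightarrow> A $$ (i, j) = cnj (A $$ (j, i))"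
  shows "hermitian_mat n A"
  unfolding hermitian_mat_def
proof
  show "mat_adjoint A = A"
  proof (rule eq_matI)
    fix i j assume "i < dim_row A" "j < dim_col A"
    then have ij: "i < n" "j < n" using A by auto
    show "mat_adjoint A $$ (i, j) = A $$ (i, j)"
      unfolding mat_adjoint_index[OF A ij] using herm[OF ij] by simp
  qed (use A mat_adjoint_carrier[OF A] in auto)
qed (rule A)

lemma hermitian_H_mat: "hermitian_mat n (H_mat n c)"
  by (rule hermitian_matI) (auto simp: H_mat_def)

text \<open>The permutation sends a vertex to the number of its predecessors.\<close>

lemma linear_order_enumeration:
  fixes R :: "nat \<Rightarrow> nat \<Rightarrow> bool"
  assumes irrefl: "\<And>i. i < n \<Longrightarrow> \<not> R i i"
    and trans: "\<And>i j k. \<lbrakk>i < n; j < n; k < n; R i j; R j k\<rbrakk> \<Longrightarrow> R i k"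
    and total: "\<And>i j. \<lbrakk>i < n; j < n; i \<noteq> j\<rbrakk> \<Longrightarrow> R i j \<or> R j i"
  obtains p where "p permutes {..<n}" "\<And>i j. \<lbrakk>i < n; j < n\<rbrakk> \<Longrightarrow> p i < p j \<longleftrightarrow> R i j"
proof -
  define rank where "rank i = card {j. j < n \<and> R j i}" for i
  have mono: "rank i < rank j" if "i < n" "j < n" "R i j" for i j
  proof -
    have "{k. k < n \<and> R k i} \<subset> {k. k < n \<and> R k j}"
      using that irrefl trans by blast
    then show ?thesis unfolding rank_def by (intro psubset_card_mono) auto
  qed
  have bound: "rank i < n" if "i < n" for i
  proof -
    have "{j. j < n \<and> R j i} \<subset> {..<n}" using irrefl that by auto
    then have "card {j. j < n \<and> R j i} < card {..<n}" by (intro psubset_card_mono) auto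
    then show ?thesis unfolding rank_def by simp
  qed
  have less_iff: "rank i < rank j \<longleftrightarrow> R i j" if "i < n" "j < n" for i j
    using mono[OF that] mono[OF that(2,1)] total[OF that] by fastforce
  define p where "p i = (if i < n then rank i else i)" for i
  have "inj_on rank {..<n}"
    using less_iff total by (intro inj_onI) (metis lessThan_iff less_irrefl)
  moreover have "rank ` {..<n} \<subseteq> {..<n}" using bound by auto
  ultimately have "bij_betw rank {..<n} {..<n}"
    by (simp add: bij_betw_def endo_inj_surj)
  then have "bij_betw p {..<n} {..<n}"
    by (rule bij_betw_cong[THEN iffD1, rotated]) (simp add: p_def)
  then have "p permutes {..<n}" by (rule bij_imp_permutes) (simp add: p_def)
  then show thesis using that less_iff by (simp add: p_def)
qed

text \<open>The matrix \<open>H\<close> after scaling and normalizing phases. For \<open>\<omega>\<close> not real, \<open>G i j = \<omega>\<close> is read as an arc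
  from \<open>i\<close> to \<open>j\<close> of a tournament in which \<open>0\<close> dominates all other vertices.\<close>

locale switching_normal_form =
  fixes n :: nat and G :: "nat \<Rightarrow> nat \<Rightarrow> complex" and \<omega> :: complex
  assumes norm_omega: "cmod \<omega> = 1"
    and herm: "\<And>i j. \<lbrakk>i < n; j < n; i \<noteq> j\<rbrakk> \<Longrightarrow> G j i = cnj (G i j)"
    and "values": "\<And>i j. \<lbrakk>i < n; j < n; i \<noteq> j\<rbrakk> \<Longrightarrow> G i j = \<omega> \<or> G i j = cnj \<omega>"
    and row0: "\<And>j. \<lbrakk>0 < j; j < n\<rbrakk> \<Longrightarrow> G 0 j = \<omega>"
    and triangles: "\<And>i j k. \<lbrakk>i < n; j < n; k < n; distinct [i, j, k]\<rbrakk> \<Longrightarrow>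
      Re (G i j * G j k * G k i) = Re \<omega>"
begin

definition cyclic :: "nat \<Rightarrow> nat \<Rightarrow> nat \<Rightarrow> bool" where
  "cyclic i j k \<longleftrightarrow> i < n \<and> j < n \<and> k < n \<and> distinct [i, j, k] \<and>
     G i j = \<omega> \<and> G j k = \<omega> \<and> G k i = \<omega>"

lemma enumeration_if_acyclic:
  assumes "Im \<omega> = 0 \<or> (\<forall>i j k. \<not> cyclic i j k)"
  obtains p where "p permutes {..<n}"
    "\<And>i j. \<lbrakk>i < n; j < n; i \<noteq> j\<rbrakk> \<Longrightarrow> G i j = (if p i < p j then \<omega> else cnj \<omega>)"
proof (cases "Im \<omega> = 0")
  case True
  then have "cnj \<omega> = \<omega>" by (simp add: complex_eq_iff)
  then show thesis using that[of id] "values" permutes_id by simp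
next
  case False
  then have ne: "cnj \<omega> \<noteq> \<omega>" by (simp add: complex_eq_iff)
  have other: "G j i = \<omega> \<longleftrightarrow> G i j \<noteq> \<omega>" if "i < n" "j < n" "i \<noteq> j" for i j
    using herm[OF that] "values"[OF that] ne by auto
  define R where "R i j \<longleftrightarrow> i \<noteq> j \<and> G i j = \<omega>" for i j
  obtain p where p: "p permutes {..<n}" and R: "\<And>i j. \<lbrakk>i < n; j < n\<rbrakk> \<Longrightarrow> p i < p j \<longleftrightarrow> R i j"
  proof (rule linear_order_enumeration)
    show "\<not> R i i" for i by (simp add: R_def)
    show "R i j \<or> R j i" if "i < n" "j < n" "i \<noteq> j" for i j using other[OF that] that by (auto simp: R_def)
    fix i j k assume ijk: "i < n" "j < n" "k < n" and "R i j" "R j k"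
    then have e: "i \<noteq> j" "j \<noteq> k" "G i j = \<omega>" "G j k = \<omega>" by (auto simp: R_def)
    then have "i \<noteq> k" using other ijk by metis
    moreover have "\<not> cyclic i j k" using assms False by blast
    ultimately show "R i k" using e ijk other[of i k] by (auto simp: R_def cyclic_def)
  qed blast
  show thesis
  proof (rule that[OF p])
    show "G i j = (if p i < p j then \<omega> else cnj \<omega>)" if "i < n" "j < n" "i \<noteq> j" for i j
      using R[OF that(1,2)] "values"[OF that] that(3) by (auto simp: R_def)
  qed
qed

text \<open>A cyclic triangle gives \<open>Re (\<omega>^3) = Re \<omega>\<close>. With \<open>x = Re \<omega>\<close> and \<open>|\<omega>| = 1\<close> this is
  \<open>4 x^3 - 3 x = x\<close>, so \<open>x\<close> is \<open>0\<close> or \<open>\<plusminus>1\<close>, and \<open>\<plusminus>1\<close> belongs to a real \<open>\<omega>\<close>.\<close>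

lemma omega_if_cyclic:
  assumes "Im \<omega> \<noteq> 0" "cyclic i j k"
  shows "\<omega> = \<i> \<or> \<omega> = - \<i>"
proof -
  let ?x = "Re \<omega>" and ?y = "Im \<omega>"
  have y: "?y\<^sup>2 = 1 - ?x\<^sup>2" using norm_omega cmod_power2[of \<omega>] by simp
  have "Re (\<omega> * \<omega> * \<omega>) = ?x"
    using triangles[of i j k] assms(2) unfolding cyclic_def by simp
  then have "?x * (?x\<^sup>2 - 3 * ?y\<^sup>2 - 1) = 0"
    by (simp add: algebra_simps power2_eq_square)
  then have "4 * (?x * ?y\<^sup>2) = 0" unfolding y by (simp add: algebra_simps)
  then have x: "?x = 0" using assms(1) by simp
  then have "?y = 1 \<or> ?y = - 1" using y by (simp add: power2_eq_1_iff)
  then show ?thesis using x by (auto simp: complex_eq_iff)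
qed

text \<open>The sum in the hypothesis runs over the squares through vertex \<open>0\<close>, simplified with the
  constant first row. For \<open>\<omega> = \<plusminus>\<i>\<close> each summand is \<open>\<plusminus>1\<close>, and a cyclic triangle attains the minimum \<open>-3\<close>. If
  this is the constant value, consecutive arcs \<open>G a b\<close>, \<open>G b c\<close> agree for all triples avoiding \<open>0\<close>,
  which four vertices do not allow.\<close>

lemma acyclic_if_squares_const:
  assumes n: "n \<ge> 5" and im: "Im \<omega> \<noteq> 0"
    and squares: "\<And>a b c. \<lbrakk>0 < a; 0 < b; 0 < c; a < n; b < n; c < n; distinct [a, b, c]\<rbrakk> \<Longrightarrow>
      Re (G a b * G b c + G a c * G c b + G b a * G a c) = q"
  shows "\<not> cyclic i j k"
proof
  assume cyc: "cyclic i j k"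
  have om: "\<omega> = \<i> \<or> \<omega> = - \<i>" by (rule omega_if_cyclic[OF im cyc])
  have ne: "cnj \<omega> \<noteq> \<omega>" using im by (simp add: complex_eq_iff)
  \<comment> \<open>Vertex \<open>0\<close> has no incoming arcs, hence lies on no cyclic triangle.\<close>
  have pos: "0 < i" "0 < j" "0 < k"
    using cyc row0[of i] row0[of j] row0[of k] herm[of 0 i] herm[of 0 j] herm[of 0 k] ne
    unfolding cyclic_def by (metis distinct_length_2_or_more not_gr_zero)+
  have ji: "G j i = cnj \<omega>" "G k j = cnj \<omega>" "G i k = cnj \<omega>"
    using cyc herm[of i j] herm[of j k] herm[of k i] unfolding cyclic_def by auto
  have "q = - 3"
    using squares[of i j k] pos cyc ji om unfolding cyclic_def by auto
  have same: "G a b = G b c"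
    if abc: "0 < a" "0 < b" "0 < c" "a < n" "b < n" "c < n" "distinct [a, b, c]" for a b c
  proof -
    have *: "G u v = \<i> \<or> G u v = - \<i>" if "u < n" "v < n" "u \<noteq> v" for u v
      using "values"[OF that] om by auto
    have "Re (G a b * G b c + G a c * G c b + G b a * G a c) = - 3"
      using squares[OF abc] \<open>q = - 3\<close> by simp
    moreover have "G b a = cnj (G a b)" "G c b = cnj (G b c)"
      using herm[of a b] herm[of b c] abc by simp_all
    moreover have "G a b = \<i> \<or> G a b = - \<i>" "G b c = \<i> \<or> G b c = - \<i>" "G a c = \<i> \<or> G a c = - \<i>"
      by (rule *; use abc in auto)+
    ultimately show ?thesis by auto
  qed
  \<comment> \<open>The arcs between \<open>2\<close> and \<open>3\<close> in both directions agree with the arc from \<open>2\<close> to \<open>4\<close>.\<close>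
  have "G 1 2 = G 2 4" "G 3 2 = G 2 4" "G 1 2 = G 2 3" by (rule same; use n in simp)+
  then have "G 3 2 = G 2 3" by simp
  moreover have "G 3 2 = cnj (G 2 3)" "G 2 3 = \<omega> \<or> G 2 3 = cnj \<omega>"
    using herm[of 2 3] "values"[of 2 3] n by auto
  ultimately show False using ne by auto
qed

end

text \<open>Products along triangles are unaffected by the phases \<open>y\<close>. Hence \<open>\<omega>\<close> can be defined from \<open>H\<close> as
  the normalized product along \<open>0\<close>, \<open>1\<close>, \<open>2\<close>, and for a constant first row the product along
  \<open>0\<close>, \<open>i\<close>, \<open>j\<close> is the entry \<open>G i j\<close> itself: it has modulus \<open>1\<close> and the same real part as \<open>\<omega>\<close>.\<close>

lemma switching_normalization:
  assumes herm: "hermitian_mat n H" and n: "n \<ge> 5"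
    and w: "\<And>i j. \<lbrakk>i < n; j < n; i \<noteq> j\<rbrakk> \<Longrightarrow> edge_weight H i j = w" "w \<noteq> 0"
    and t: "\<And>i j k. \<lbrakk>i < n; j < n; k < n; distinct [i, j, k]\<rbrakk> \<Longrightarrow> triangle_weight H i j k = \<tau>"
  obtains r y \<omega> where "0 < (r::real)" "\<And>i. i < n \<Longrightarrow> cmod (y i) = 1"
    "switching_normal_form n (\<lambda>i j. cnj (y i) * H $$ (i,j) * y j / of_real r) \<omega>"
proof -
  define r where "r = cmod (H $$ (0,1))"
  have w_norm: "w = of_real ((cmod (H $$ (i,j)))\<^sup>2)" if "i < n" "j < n" "i \<noteq> j" for i j
    using w(1)[OF that] hermitian_mat_cnj[OF herm that(1,2)]
    by (simp add: edge_weight_def complex_norm_square del: of_real_power)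
  have r: "cmod (H $$ (i,j)) = r" if "i < n" "j < n" "i \<noteq> j" for i j
  proof (rule power2_eq_imp_eq)
    have "complex_of_real ((cmod (H $$ (i,j)))\<^sup>2) = complex_of_real (r\<^sup>2)"
      using w_norm[OF that] w_norm[of 0 1] n unfolding r_def by simp
    then show "(cmod (H $$ (i,j)))\<^sup>2 = r\<^sup>2" by (simp only: of_real_eq_iff)
  qed (simp_all add: r_def)
  have "r \<noteq> 0" using w_norm[of 0 1] w(2) n by (auto simp: r_def)
  then have rpos: "0 < r" by (simp add: r_def)
  define \<omega> where "\<omega> = H $$ (0,1) * H $$ (1,2) * H $$ (2,0) / of_real (r ^ 3)"
  have norm_om: "cmod \<omega> = 1"
    using rpos n r[of 0 1] r[of 1 2] r[of 2 0]
    by (simp add: \<omega>_def norm_mult norm_divide norm_power power3_eq_cube)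
  \<comment> \<open>The phase at \<open>0\<close> turns the constant value \<open>1\<close> of the normalized first row into \<open>\<omega>\<close>.\<close>
  define y where "y i = (if i = 0 then cnj \<omega> else cnj (H $$ (0,i)) / of_real r)" for i
  have norm_y: "cmod (y i) = 1" if "i < n" for i
    using that norm_om rpos r[of 0 i] n by (simp add: y_def norm_divide)
  define G where "G i j = cnj (y i) * H $$ (i,j) * y j / of_real r" for i j
  have norm_G: "cmod (G i j) = 1" if "i < n" "j < n" "i \<noteq> j" for i j
    using that norm_y r[OF that] rpos by (simp add: G_def norm_mult norm_divide)
  have G_cnj: "G j i = cnj (G i j)" if "i < n" "j < n" for i j
    using hermitian_mat_cnj[OF herm that] by (simp add: G_def mult_ac)
  have G0: "G 0 j = \<omega>" if "0 < j" "j < n" for j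
  proof -
    have "H $$ (0,j) * cnj (H $$ (0,j)) = of_real (r\<^sup>2)"
      using r[of 0 j] that by (simp add: complex_norm_square[symmetric])
    then show ?thesis
      using that rpos by (simp add: G_def y_def power2_eq_square mult.assoc)
  qed
  have triple: "G i j * G j k * G k i = H $$ (i,j) * H $$ (j,k) * H $$ (k,i) / of_real (r ^ 3)"
    if "i < n" "j < n" "k < n" for i j k
  proof -
    have "G i j * G j k * G k i = (y i * cnj (y i)) * (y j * cnj (y j)) * (y k * cnj (y k))
        * (H $$ (i,j) * H $$ (j,k) * H $$ (k,i)) / of_real (r ^ 3)"
      by (simp add: G_def power3_eq_cube)
    then show ?thesis using unit_mult_cnj(1)[OF norm_y] that by simp
  qed
  have triangle_Re: "Re (G i j * G j k * G k i) = Re \<tau> / (2 * r ^ 3)"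
    if ijk: "i < n" "j < n" "k < n" "distinct [i, j, k]" for i j k
  proof -
    have "\<tau> = H $$ (i,j) * H $$ (j,k) * H $$ (k,i) + cnj (H $$ (i,j) * H $$ (j,k) * H $$ (k,i))"
      using t[OF ijk] hermitian_mat_cnj[OF herm ijk(1,2)] hermitian_mat_cnj[OF herm ijk(2,3)]
        hermitian_mat_cnj[OF herm ijk(3,1)] unfolding triangle_weight_def
      by (simp add: mult_ac)
    then have "Re \<tau> = 2 * Re (H $$ (i,j) * H $$ (j,k) * H $$ (k,i))"
      by (simp only: plus_complex.simps cnj.simps mult_2)
    then show ?thesis unfolding triple[OF ijk(1-3)] Re_divide_of_real
      using rpos by (simp del: times_complex.simps)
  qed
  have om_triple: "G 0 1 * G 1 2 * G 2 0 = \<omega>" using triple[of 0 1 2] n by (simp add: \<omega>_def)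
  have "Re \<omega> = Re \<tau> / (2 * r ^ 3)" using triangle_Re[of 0 1 2] n unfolding om_triple by simp
  then have Re_om: "Re (G i j * G j k * G k i) = Re \<omega>"
    if "i < n" "j < n" "k < n" "distinct [i, j, k]" for i j k
    using triangle_Re[OF that] by simp
  have G_values: "G i j = \<omega> \<or> G i j = cnj \<omega>" if ij: "i < n" "j < n" "i \<noteq> j" for i j
  proof -
    consider "i = 0" | "j = 0" | "0 < i" "0 < j" by auto
    then show ?thesis
    proof cases
      case 1
      then show ?thesis using G0[of j] ij by simp
    next
      case 2
      then show ?thesis using G0[of i] G_cnj[of 0 i] ij by simp
    next
      case 3
      have "G 0 i * G i j * G j 0 = G i j"
        using G0[of i] G0[of j] G_cnj[of 0 j] 3 ij unit_mult_cnj(1)[OF norm_om] by (simp add: mult_ac)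
      moreover have "Re (G 0 i * G i j * G j 0) = Re \<omega>" by (rule Re_om) (use 3 ij in auto)
      ultimately have re: "Re (G i j) = Re \<omega>" by (simp only:)
      have "(Im (G i j))\<^sup>2 = (Im \<omega>)\<^sup>2"
        using cmod_power2[of "G i j"] cmod_power2[of \<omega>] norm_G[OF ij] norm_om re by simp
      then show ?thesis using re by (auto simp: power2_eq_iff complex_eq_iff)
    qed
  qed
  have "switching_normal_form n G \<omega>"
    by unfold_locales
      (rule norm_om, rule G_cnj, assumption+, rule G_values, assumption+, rule G0, assumption+,
        rule Re_om, assumption+)
  then show thesis unfolding G_def by (intro that[of r y \<omega>] rpos norm_y)
qed

lemma hermitian_const_diag_real:
  assumes "hermitian_mat n H" "i < n" "H $$ (i,i) = \<delta>"
  shows "\<delta> = of_real (Re \<delta>)"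
  using hermitian_mat_cnj[OF assms(1,2,2)] assms(3) by (simp add: complex_eq_iff)

text \<open>The diagonal \<open>\<delta>\<close> of a Hermitian matrix is real, so it can be removed by the shift \<open>b\<close> that
  \<open>\<Gamma>\<close>-equivalence permits.\<close>

lemma Gamma_equivalent_normalized:
  assumes H: "hermitian_mat n H" and B: "hermitian_mat n B" and p: "p permutes {..<n}"
    and r: "0 < r" and y: "\<And>i. i < n \<Longrightarrow> cmod (y i) = 1"
    and H_diag: "\<And>i. i < n \<Longrightarrow> H $$ (i,i) = \<delta>" and B_diag: "\<And>i. i < n \<Longrightarrow> B $$ (i,i) = 0"
    and off_diag: "\<And>i j. \<lbrakk>i < n; j < n; i \<noteq> j\<rbrakk> \<Longrightarrow>
      B $$ (p i, p j) = cnj (y i) * H $$ (i,j) * y j / of_real r"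
  shows "Gamma_equivalent n H B"
proof -
  have entries: "B $$ (p i, p j) = complex_of_real (1 / r) * (cnj (y i) * H $$ (i,j) * cnj (cnj (y j)))
      + (if i = j then complex_of_real (- Re \<delta> / r) else 0)" if ij: "i < n" "j < n" for i j
  proof (cases "i = j")
    case True
    have "cnj (y i) * H $$ (i,i) * y i = complex_of_real (Re \<delta>)"
      using hermitian_const_diag_real[OF H ij(1) H_diag[OF ij(1)]] H_diag[OF ij(1)]
        unit_mult_cnj(2)[OF y[OF ij(1)]] by (simp add: mult_ac)
    then show ?thesis using True B_diag[OF permutes_less[OF p ij(2)]] by simp
  next
    case False
    then show ?thesis using off_diag[OF ij] by simp
  qed
  have "1 / r \<noteq> 0" using r by simp
  moreover have "\<forall>i<n. cmod (cnj (y i)) = 1" using y by simp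
  ultimately show ?thesis
    unfolding Gamma_equivalent_iff_entries
    by (intro conjI[OF H conjI[OF B]] exI[of _ "1 / r"] exI[of _ "- Re \<delta> / r"] exI[of _ p]
        exI[of _ "\<lambda>i. cnj (y i)"] conjI allI impI p entries) simp_all
qed

lemma Gamma_equivalent_scalar:
  assumes H: "hermitian_mat n H" and diag: "\<And>i. i < n \<Longrightarrow> H $$ (i,i) = \<delta>"
    and edges: "\<And>i j. \<lbrakk>i < n; j < n; i \<noteq> j\<rbrakk> \<Longrightarrow> edge_weight H i j = 0"
  shows "Gamma_equivalent n H (H_mat n 0)"
proof (rule Gamma_equivalent_normalized[OF H hermitian_H_mat, where p = id and r = 1 and y = "\<lambda>_. 1"])
  fix i j assume ij: "i < n" "j < n" "i \<noteq> j"
  have "H $$ (i,j) = 0"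
    using edges[OF ij] hermitian_mat_cnj[OF H ij(1,2)] by (simp add: edge_weight_def)
  then show "H_mat n 0 $$ (id i, id j) = cnj 1 * H $$ (i,j) * 1 / of_real 1"
    using ij by (simp add: H_mat_def)
qed (use diag in \<open>auto simp: permutes_id H_mat_def\<close>)

lemma (in switching_normal_form) Gamma_equivalent_if_acyclic:
  assumes H: "hermitian_mat n H" and diag: "\<And>i. i < n \<Longrightarrow> H $$ (i,i) = \<delta>"
    and r: "0 < r" and y: "\<And>i. i < n \<Longrightarrow> cmod (y i) = 1"
    and G: "G = (\<lambda>i j. cnj (y i) * H $$ (i,j) * y j / of_real r)"
    and acyclic: "Im \<omega> = 0 \<or> (\<forall>i j k. \<not> cyclic i j k)"
  shows "Gamma_equivalent n H (H_mat n \<omega>)"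
proof -
  obtain p where p: "p permutes {..<n}"
    and enum: "\<And>i j. \<lbrakk>i < n; j < n; i \<noteq> j\<rbrakk> \<Longrightarrow> G i j = (if p i < p j then \<omega> else cnj \<omega>)"
    by (rule enumeration_if_acyclic[OF acyclic]) blast
  show ?thesis
  proof (rule Gamma_equivalent_normalized[OF H hermitian_H_mat p r y diag])
    fix i j assume ij: "i < n" "j < n" "i \<noteq> j"
    have "p i \<noteq> p j" using ij permutes_eq_iff[OF p] by simp
    then have "H_mat n \<omega> $$ (p i, p j) = G i j"
      using enum[OF ij] permutes_less[OF p] ij by (auto simp: H_mat_def)
    then show "H_mat n \<omega> $$ (p i, p j) = cnj (y i) * H $$ (i,j) * y j / of_real r"
      by (simp add: G)
  qed (auto simp: H_mat_def)
qed

lemma (in switching_normal_form) Gamma_equivalent_skew: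
  assumes H: "hermitian_mat n H" and diag: "\<And>i. i < n \<Longrightarrow> H $$ (i,i) = \<delta>"
    and r: "0 < r" and y: "\<And>i. i < n \<Longrightarrow> cmod (y i) = 1"
    and G: "G = (\<lambda>i j. cnj (y i) * H $$ (i,j) * y j / of_real r)"
    and om: "\<omega> = \<i> \<or> \<omega> = - \<i>"
  shows "\<exists>S. skew_symmetric_mat n S \<and> (\<forall>i<n. \<forall>j<n. i \<noteq> j \<longrightarrow> S $$ (i, j) \<in> {-1, 1}) \<and>
    Gamma_equivalent n H (\<i> \<cdot>\<^sub>m S)"
proof (intro exI conjI)
  define S where "S = mat n n (\<lambda>(i, j). if i = j then 0 else - \<i> * G i j)"
  have S: "S \<in> carrier_mat n n" by (simp add: S_def)
  have G_i: "G i j = \<i> \<and> G j i = - \<i> \<or> G i j = - \<i> \<and> G j i = \<i>" if "i < n" "j < n" "i \<noteq> j" for i j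
    using "values"[OF that] herm[OF that] om by auto
  show "skew_symmetric_mat n S"
    unfolding skew_symmetric_mat_def
  proof
    show "transpose_mat S = - S"
    proof (rule eq_matI)
      fix i j assume "i < dim_row (- S)" "j < dim_col (- S)"
      then have ij: "i < n" "j < n" using S by auto
      then show "transpose_mat S $$ (i,j) = (- S) $$ (i,j)"
        using G_i[of i j] by (auto simp: S_def)
    qed (use S in auto)
  qed (rule S)
  show "\<forall>i<n. \<forall>j<n. i \<noteq> j \<longrightarrow> S $$ (i, j) \<in> {-1, 1}"
    using G_i by (auto simp: S_def) fastforce
  have iS: "(\<i> \<cdot>\<^sub>m S) $$ (i,j) = (if i = j then 0 else G i j)" if "i < n" "j < n" for i j
    using that by (simp add: S_def)
  show "Gamma_equivalent n H (\<i> \<cdot>\<^sub>m S)"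
  proof (rule Gamma_equivalent_normalized[OF H _ permutes_id r y diag])
    show "hermitian_mat n (\<i> \<cdot>\<^sub>m S)"
    proof (rule hermitian_matI)
      show "(\<i> \<cdot>\<^sub>m S) $$ (i,j) = cnj ((\<i> \<cdot>\<^sub>m S) $$ (j,i))" if "i < n" "j < n" for i j
        unfolding iS[OF that] iS[OF that(2,1)] using herm[of j i] that by simp
    qed (use S in simp)
    show "(\<i> \<cdot>\<^sub>m S) $$ (id i, id j) = cnj (y i) * H $$ (i,j) * y j / of_real r"
      if "i < n" "j < n" "i \<noteq> j" for i j
      using iS[OF that(1,2)] that(3) by (simp add: G)
  qed (use iS in auto)
qed


section \<open>The two families of monomorphic matrices\<close>

text \<open>Listing \<open>\<alpha>\<close> increasingly preserves the order of the indices, on which the entries of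
  \<^const>\<open>H_mat\<close> depend.\<close>

lemma spectrally_monomorphic_H_mat: "spectrally_monomorphic n k (H_mat n c)"
proof -
  have carrier: "H_mat n c \<in> carrier_mat n n" by (simp add: H_mat_def)
  have "submatrix (H_mat n c) \<alpha> \<alpha> = H_mat k c" if \<alpha>: "\<alpha> \<subseteq> {..<n}" "card \<alpha> = k" for \<alpha>
  proof -
    let ?xs = "sorted_list_of_set \<alpha>"
    have fin: "finite \<alpha>" using \<alpha> finite_subset by blast
    have len: "length ?xs = k" using \<alpha> by simp
    have less: "?xs ! i < ?xs ! j" if "i < j" "j < k" for i j
      by (rule sorted_wrt_nth_less[OF strict_sorted_list_of_set]) (use that len in auto)
    have "?xs ! i < n" if "i < k" for i
      using nth_mem[of i ?xs] that len fin \<alpha>(1) by auto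
    moreover have "?xs ! i < ?xs ! j \<longleftrightarrow> i < j" if "i < k" "j < k" for i j
      using less[of i j] less[of j i] that by (metis less_asym linorder_neqE_nat less_irrefl)
    ultimately show ?thesis
      unfolding submatrix_eq_principal[OF carrier \<alpha>(1)]
      by (intro eq_matI) (simp_all add: principal_def H_mat_def \<alpha>(2))
  qed
  then show ?thesis unfolding spectrally_monomorphic_def using carrier by simp
qed

text \<open>The product of three entries \<open>\<plusminus>\<i>\<close> is imaginary, so that the triangle weights vanish, while all edge
  weights are \<open>1\<close>.\<close>

lemma spectrally_monomorphic_3_skew:
  assumes S: "skew_symmetric_mat n S"
    and pm: "\<And>i j. \<lbrakk>i < n; j < n; i \<noteq> j\<rbrakk> \<Longrightarrow> S $$ (i,j) \<in> {-1, 1}"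
  shows "spectrally_monomorphic n 3 (\<i> \<cdot>\<^sub>m S)"
proof -
  have S_carrier: "S \<in> carrier_mat n n" and T: "transpose_mat S = - S"
    using S by (auto simp: skew_symmetric_mat_def)
  have skew: "S $$ (j,i) = - S $$ (i,j)" if "i < n" "j < n" for i j
    using arg_cong[OF T, of "\<lambda>M. M $$ (i,j)"] that S_carrier by simp
  have carrier: "\<i> \<cdot>\<^sub>m S \<in> carrier_mat n n" using S_carrier by simp
  have entry: "(\<i> \<cdot>\<^sub>m S) $$ (i,j) = \<i> * S $$ (i,j)" if "i < n" "j < n" for i j
    using that S_carrier by simp
  have diag: "(\<i> \<cdot>\<^sub>m S) $$ (i,i) = 0" if "i < n" for i
    using skew[OF that that] entry[OF that that] by simp
  have edge: "edge_weight (\<i> \<cdot>\<^sub>m S) i j = 1" if "i < n" "j < n" "i \<noteq> j" for i j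
    using pm[OF that] skew[OF that(1,2)] that by (auto simp: edge_weight_def entry)
  have triangle: "triangle_weight (\<i> \<cdot>\<^sub>m S) i j k = 0" if "i < n" "j < n" "k < n" for i j k
    using skew[OF that(1,2)] skew[OF that(2,3)] skew[OF that(1,3)] that
    by (simp add: triangle_weight_def entry)
  have "char_poly (principal (\<i> \<cdot>\<^sub>m S) xs) = [:0, - 3, 0, 1:]"
    if xs: "distinct xs" "length xs = 3" "set xs \<subseteq> {..<n}" for xs
  proof -
    obtain a b c where [simp]: "xs = [a, b, c]"
      using xs(2) by (auto simp: numeral_3_eq_3 length_Suc_conv)
    have abc: "a < n" "b < n" "c < n" "a \<noteq> b" "a \<noteq> c" "b \<noteq> c" using xs by auto
    have "poly (char_poly (principal (\<i> \<cdot>\<^sub>m S) [a, b, c])) x = poly [:0, - 3, 0, 1:] x" for x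
      using poly_char_poly_principal_3_const_diag[of "\<i> \<cdot>\<^sub>m S" a 0 b c x] abc
      by (simp add: diag edge triangle del: index_smult_mat)
    then show ?thesis by (simp add: poly_eq_poly_eq_iff[symmetric] fun_eq_iff)
  qed
  then show ?thesis unfolding spectrally_monomorphic_iff_lists[OF carrier] by metis
qed


section \<open>Classification\<close>

lemma square_weight_normalized:
  assumes H: "hermitian_mat n H" and r: "0 < r" and y: "\<And>i. i < n \<Longrightarrow> cmod (y i) = 1"
    and G: "G = (\<lambda>i j. cnj (y i) * H $$ (i,j) * y j / of_real r)"
    and ijkl: "i < n" "j < n" "k < n" "l < n"
  shows "Re (square_weight H i j k l) = 2 * r ^ 4 * Re (G i j * G j k * G k l * G l i)"
proof -
  let ?h = "H $$ (i,j) * H $$ (j,k) * H $$ (k,l) * H $$ (l,i)"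
  have "square_weight H i j k l = ?h + cnj ?h"
    using hermitian_mat_cnj[OF H ijkl(1,2)] hermitian_mat_cnj[OF H ijkl(2,3)]
      hermitian_mat_cnj[OF H ijkl(3,4)] hermitian_mat_cnj[OF H ijkl(4,1)]
    unfolding square_weight_def by (simp add: mult_ac)
  then have "Re (square_weight H i j k l) = 2 * Re ?h"
    by (simp only: plus_complex.simps cnj.simps mult_2)
  moreover have "G i j * G j k * G k l * G l i = ?h / of_real (r ^ 4)"
  proof -
    have "G i j * G j k * G k l * G l i = (y i * cnj (y i)) * (y j * cnj (y j)) * (y k * cnj (y k))
        * (y l * cnj (y l)) * ?h / of_real (r ^ 4)"
      by (simp add: G power4_eq_xxxx)
    then show ?thesis using unit_mult_cnj(1)[OF y] ijkl by simp
  qed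
  ultimately show ?thesis using r by (simp add: Re_divide_of_real del: of_real_power times_complex.simps)
qed

lemma spectrally_monomorphic_3_classification:
  assumes H: "hermitian_mat n H" and n: "n \<ge> 5" and mono: "spectrally_monomorphic n 3 H"
  shows "(\<exists>c. Gamma_equivalent n H (H_mat n c)) \<or>
    (\<exists>S. skew_symmetric_mat n S \<and> (\<forall>i<n. \<forall>j<n. i \<noteq> j \<longrightarrow> S $$ (i, j) \<in> {-1, 1}) \<and>
       Gamma_equivalent n H (\<i> \<cdot>\<^sub>m S))"
proof -
  obtain \<delta> w \<tau> where diag: "\<And>i. i < n \<Longrightarrow> H $$ (i,i) = \<delta>"
    and edges: "\<And>i j. \<lbrakk>i < n; j < n; i \<noteq> j\<rbrakk> \<Longrightarrow> edge_weight H i j = w"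
    and triangles: "\<And>i j k. \<lbrakk>i < n; j < n; k < n; distinct [i, j, k]\<rbrakk> \<Longrightarrow> triangle_weight H i j k = \<tau>"
    by (rule spectrally_monomorphic_3_weights[OF n mono]) blast
  show ?thesis
  proof (cases "w = 0")
    case True
    then show ?thesis using Gamma_equivalent_scalar[OF H diag] edges by blast
  next
    case False
    obtain r y \<omega> where r: "0 < (r::real)" and y: "\<And>i. i < n \<Longrightarrow> cmod (y i) = 1"
      and nf: "switching_normal_form n (\<lambda>i j. cnj (y i) * H $$ (i,j) * y j / of_real r) \<omega>"
      by (rule switching_normalization[OF H n edges False triangles]) blast+
    interpret switching_normal_form n "\<lambda>i j. cnj (y i) * H $$ (i,j) * y j / of_real r" \<omega> by (rule nf)
    show ?thesis
    proof (cases "Im \<omega> = 0 \<or> (\<forall>i j k. \<not> cyclic i j k)")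
      case True
      then show ?thesis using Gamma_equivalent_if_acyclic[OF H diag r y refl] by blast
    next
      case False
      then have "\<omega> = \<i> \<or> \<omega> = - \<i>" using omega_if_cyclic by blast
      then show ?thesis using Gamma_equivalent_skew[OF H diag r y refl] by blast
    qed
  qed
qed

lemma spectrally_monomorphic_4_classification:
  assumes H: "hermitian_mat n H" and n: "n \<ge> 7" and mono: "spectrally_monomorphic n 4 H"
  shows "\<exists>c. Gamma_equivalent n H (H_mat n c)"
proof -
  obtain \<delta> w \<tau> \<sigma> where diag: "\<And>i. i < n \<Longrightarrow> H $$ (i,i) = \<delta>"
    and edges: "\<And>i j. \<lbrakk>i < n; j < n; i \<noteq> j\<rbrakk> \<Longrightarrow> edge_weight H i j = w"
    and triangles: "\<And>i j k. \<lbrakk>i < n; j < n; k < n; distinct [i, j, k]\<rbrakk> \<Longrightarrow> triangle_weight H i j k = \<tau>"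
    and squares: "\<And>i j k l. \<lbrakk>i < n; j < n; k < n; l < n; distinct [i, j, k, l]\<rbrakk> \<Longrightarrow>
       square_weight H i j k l + square_weight H i j l k + square_weight H i k j l = \<sigma>"
    by (rule spectrally_monomorphic_4_weights[OF n mono]) blast
  show ?thesis
  proof (cases "w = 0")
    case True
    then show ?thesis using Gamma_equivalent_scalar[OF H diag] edges by blast
  next
    case False
    have n5: "n \<ge> 5" using n by simp
    obtain r y \<omega> where r: "0 < (r::real)" and y: "\<And>i. i < n \<Longrightarrow> cmod (y i) = 1"
      and nf: "switching_normal_form n (\<lambda>i j. cnj (y i) * H $$ (i,j) * y j / of_real r) \<omega>"
      by (rule switching_normalization[OF H n5 edges False triangles]) blast+
    define G where "G = (\<lambda>i j. cnj (y i) * H $$ (i,j) * y j / of_real r)"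
    interpret switching_normal_form n G \<omega> using nf by (simp only: G_def)
    have through_0: "Re (square_weight H 0 a b c) = 2 * r ^ 4 * Re (G a b * G b c)"
      if abc: "0 < a" "0 < c" "a < n" "b < n" "c < n" for a b c
    proof -
      have "G 0 a * G a b * G b c * G c 0 = G a b * G b c * (\<omega> * cnj \<omega>)"
        using row0[of a] row0[of c] herm[of 0 c] abc by simp
      also have "\<dots> = G a b * G b c" using unit_mult_cnj(1)[OF norm_omega] by simp
      finally have G_quad: "G 0 a * G a b * G b c * G c 0 = G a b * G b c" .
      have "Re (square_weight H 0 a b c) = 2 * r ^ 4 * Re (G 0 a * G a b * G b c * G c 0)"
        by (rule square_weight_normalized[OF H r y G_def]) (use abc in auto)
      then show ?thesis unfolding G_quad .
    qed
    have "Re (G a b * G b c + G a c * G c b + G b a * G a c) = Re \<sigma> / (2 * r ^ 4)"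
      if abc: "0 < a" "0 < b" "0 < c" "a < n" "b < n" "c < n" "distinct [a, b, c]" for a b c
    proof -
      have "Re \<sigma> = Re (square_weight H 0 a b c) + Re (square_weight H 0 a c b) + Re (square_weight H 0 b a c)"
        using squares[of 0 a b c] abc by auto
      also have "\<dots> = 2 * r ^ 4 * Re (G a b * G b c + G a c * G c b + G b a * G a c)"
      proof -
        have eqs: "Re (square_weight H 0 a b c) = 2 * r ^ 4 * Re (G a b * G b c)"
          "Re (square_weight H 0 a c b) = 2 * r ^ 4 * Re (G a c * G c b)"
          "Re (square_weight H 0 b a c) = 2 * r ^ 4 * Re (G b a * G a c)"
          by (rule through_0; use abc in simp)+
        show ?thesis unfolding eqs by (simp only: plus_complex.simps distrib_left)
      qed
      finally show ?thesis using r by (simp del: times_complex.simps plus_complex.simps)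
    qed
    then have "Im \<omega> = 0 \<or> (\<forall>i j k. \<not> cyclic i j k)"
      using acyclic_if_squares_const[OF n5] by blast
    then show ?thesis using Gamma_equivalent_if_acyclic[OF H diag r y G_def] by blast
  qed
qed

theorem theorem3p2:
  fixes n :: nat and H :: "complex mat"
  assumes "hermitian_mat n H"
  shows "(n \<ge> 5 \<longrightarrow>
           (spectrally_monomorphic n 3 H \<longleftrightarrow>
             (\<exists>c :: complex. Gamma_equivalent n H (H_mat n c)) \<or>
             (\<exists>S :: complex mat. skew_symmetric_mat n S \<and>
                (\<forall>i<n. \<forall>j<n. i \<noteq> j \<longrightarrow> S $$ (i, j) \<in> {-1, 1}) \<and>
                Gamma_equivalent n H (\<i> \<cdot>\<^sub>m S)))) \<and>
         (n \<ge> 7 \<longrightarrow>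
           (spectrally_monomorphic n 4 H \<longleftrightarrow>
             (\<exists>c :: complex. Gamma_equivalent n H (H_mat n c))))"
proof -
  have H_mat: "spectrally_monomorphic n k H" if "Gamma_equivalent n H (H_mat n c)" for k c
    using Gamma_equivalent_spectrally_monomorphic[OF that] spectrally_monomorphic_H_mat by blast
  have skew: "spectrally_monomorphic n 3 H"
    if "Gamma_equivalent n H (\<i> \<cdot>\<^sub>m S)" "skew_symmetric_mat n S"
      "\<forall>i<n. \<forall>j<n. i \<noteq> j \<longrightarrow> S $$ (i, j) \<in> {-1, 1}" for S
    using Gamma_equivalent_spectrally_monomorphic[OF that(1)] spectrally_monomorphic_3_skew[OF that(2)] that(3)
    by blast
  show ?thesis
    using H_mat skew spectrally_monomorphic_3_classification[OF assms] spectrally_monomorphic_4_classification[OF assms] by meson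
qed

end
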